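(* Consider the five quadruples $(n,m,M_{90},M_{99})$: $$(30,20,33,37),\quad (50,20,1912,2145),\quad (50,30,96,103),\quad (60,30,420,454),\quad (70,40,197,209).$$ For each of these quadruples the following hold, assuming $\chi_{m,n}(M)\ge 1/2$ for the value of $M$ in question. (1) If $M=M_{90}$, then for at least $90\%$ of the matrices $A\in G'_{m,n}(M)$, and all right-hand sides $b\in\mathbb{Z}^m$, reverse branch-and-bound solves the RKZ-nullspace reformulation of the problem $$Ax=b,\qquad x\in\{0,1\}^n$$ at the rootnode. (2) If $M=M_{99}$, then the same is true for at least $99\%$ of the matrices $A\in G'_{m,n}(M)$.
   Context: Matrix sets. $G_{m,n}(M)$ is the set of $m\times n$ matrices with entries in $\{1,\dots,M\}$; $G'_{m,n}(M)$ is the subset of those with linearly independent rows; $\chi_{m,n}(M) = |G'_{m,n}(M)|/|G_{m,n}(M)|$. Lattices and RKZ reduction. A lattice is $L = \{Bx : x \in \mathbb{Z}^r\}$, with $B$ a real matrix with $r$ linearly independent columns $b_1,\dots,b_r$ (a basis of $L$). The Gram-Schmidt vectors are $b_1^* = b_1$ and $b_i^*$ = the projection of $b_i$ onto the orthogonal complement of the span of $b_1,\dots,b_{i-1}$; $\mu_{ij} = \langle b_i,b_j^*\rangle/\|b_j^*\|^2$ for $j<i$. For $1\le k\le i\le r$ let $b_i(k) = b_i^* + \sum_{j=k}^{i-1}\mu_{ij}b_j^*$, and let $L_i$ be the lattice generated by $b_i(i), b_{i+1}(i),\dots,b_r(i)$. The basis is Korkhine-Zolotarev (KZ) reduced if $b_i(i)$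 is a shortest nonzero vector (in Euclidean norm) of $L_i$ for every $i$. The reciprocal lattice of $L$ is $L' = \{z \in \operatorname{lin} L : \langle z,x\rangle \in \mathbb{Z}\ \forall x\in L\}$ ($\operatorname{lin}$ is linear span); the reciprocal basis of $b_1,\dots,b_r$ is the basis $b_1',\dots,b_r'$ of $L'$ with $\langle b_i,b_j'\rangle = 1$ if $i+j=r+1$ and $0$ otherwise. The basis is reciprocal Korkhine-Zolotarev (RKZ) reduced if its reciprocal basis is a KZ reduced basis of $L'$. Reformulation. The RKZ-nullspace reformulation of "$Ax=b$, $x\in\{0,1\}^n$" is: find $y \in Q_N\cap\mathbb{Z}^{n-m}$, where $Q_N = \{y \in \mathbb{R}^{n-m} : -x_0 \le By \le e - x_0\}$, $e$ is the vector of all ones, $x_0\in\mathbb{Z}^n$ satisfies $Ax_0=b$, and the columns of $B$ are an RKZ reduced basis of $\{x\in\mathbb{Z}^n : Ax=0\}$. (If no such $x_0$ exists, the problem is infeasible and there is no reformulated problem to solve.) The assertion is for any admissible choice of $B$ and $x_0$. Branch-and-bound. Reverse branch-and-bound applied to a polyhedron $P\subset\mathbb{R}^r$ in variables $y_1,\dots,y_r$ starts with $P$ as the sole subproblem and branches on the variables in the order $y_r, y_{r-1},\dots,y_1$: branching on $y_i$ in a subproblem $P'$ creates the nodes $P'\cap\{y : y_i=\gamma\}$, where $\gamma$ ranges over all integers with $\min\{y_i : y\in P'\}\le\gamma\le\max\{y_i : y\in P'\}$ (no nodes if $P'$ is empty). This is repeated until all subproblems are shown to be empty or an integral point is found. The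 nodes created by branching on $y_i$ form the level of $y_i$. Branch-and-bound solves the problem at the rootnode if it generates at most one node at each level of the tree. *)

theory Defs
  imports "HOL-Analysis.Analysis"
begin

section \<open>Matrix sets\<close>

(* An m x n matrix has type 'a^'n^'m with CARD('m) = m and CARD('n) = n. *)

definition real_vec :: "int^'n \<Rightarrow> real^'n" where
  "real_vec x = (\<chi> i. real_of_int (x $ i))"

definition mat_G :: "nat \<Rightarrow> (int^'n^'m) set" where
  "mat_G M = {A. \<forall>i j. A $ i $ j \<in> {1..int M}}"

(* Injectivity is needed because independent speaks about the set of rows,
   which would hide a repeated row. *)
definition indep_rows :: "int^'n^'m \<Rightarrow> bool" where
  "indep_rows A \<longleftrightarrow>
     inj (\<lambda>i. row i (map_matrix real_of_int A)) \<and> independent (rows (map_matrix real_of_int A))"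

definition mat_G' :: "nat \<Rightarrow> (int^'n^'m) set" where
  "mat_G' M = {A \<in> mat_G M. indep_rows A}"

definition mat_chi :: "'m::finite itself \<Rightarrow> 'n::finite itself \<Rightarrow> nat \<Rightarrow> real" where
  "mat_chi _ _ M = real (card (mat_G' M :: (int^'n^'m) set)) / real (card (mat_G M :: (int^'n^'m) set))"


section \<open>Lattices and reduced bases\<close>

(* A system b_1, ..., b_r is a function on nat of which only the values on {1..r} matter. *)

definition lattice_gen :: "nat set \<Rightarrow> (nat \<Rightarrow> 'a::real_vector) \<Rightarrow> 'a set" where
  "lattice_gen I b = {\<Sum>i\<in>I. real_of_int (c i) *\<^sub>R b i | c :: nat \<Rightarrow> int. True}"

definition lattice_basis :: "nat \<Rightarrow> (nat \<Rightarrow> 'a::real_vector) \<Rightarrow> 'a set \<Rightarrow> bool" where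
  "lattice_basis r b L \<longleftrightarrow>
     inj_on b {1..r} \<and> independent (b ` {1..r}) \<and> L = lattice_gen {1..r} b"

definition gso :: "(nat \<Rightarrow> 'a::euclidean_space) \<Rightarrow> nat \<Rightarrow> 'a" where
  "gso b i = closest_point (orthogonal_comp (span (b ` {1..<i}))) (b i)"

definition gso_mu :: "(nat \<Rightarrow> 'a::euclidean_space) \<Rightarrow> nat \<Rightarrow> nat \<Rightarrow> real" where
  "gso_mu b i j = (b i \<bullet> gso b j) / (norm (gso b j))\<^sup>2"

(* b_i(k) *)
definition gso_tail :: "(nat \<Rightarrow> 'a::euclidean_space) \<Rightarrow> nat \<Rightarrow> nat \<Rightarrow> 'a" where
  "gso_tail b i k = gso b i + (\<Sum>j\<in>{k..<i}. gso_mu b i j *\<^sub>R gso b j)"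

definition shortest_nonzero :: "'a::real_normed_vector set \<Rightarrow> 'a \<Rightarrow> bool" where
  "shortest_nonzero L v \<longleftrightarrow> v \<in> L \<and> v \<noteq> 0 \<and> (\<forall>w\<in>L. w \<noteq> 0 \<longrightarrow> norm v \<le> norm w)"

definition KZ_reduced_basis :: "nat \<Rightarrow> (nat \<Rightarrow> 'a::euclidean_space) \<Rightarrow> 'a set \<Rightarrow> bool" where
  "KZ_reduced_basis r b L \<longleftrightarrow> lattice_basis r b L \<and>
     (\<forall>i\<in>{1..r}. shortest_nonzero (lattice_gen {i..r} (\<lambda>j. gso_tail b j i)) (gso_tail b i i))"

definition reciprocal_lattice :: "'a::euclidean_space set \<Rightarrow> 'a set" where
  "reciprocal_lattice L = {z \<in> span L. \<forall>x\<in>L. z \<bullet> x \<in> \<int>}"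

definition reciprocal_basis :: "nat \<Rightarrow> (nat \<Rightarrow> 'a::euclidean_space) \<Rightarrow> (nat \<Rightarrow> 'a) \<Rightarrow> bool" where
  "reciprocal_basis r b b' \<longleftrightarrow>
     lattice_basis r b' (reciprocal_lattice (lattice_gen {1..r} b)) \<and>
     (\<forall>i\<in>{1..r}. \<forall>j\<in>{1..r}. b i \<bullet> b' j = (if i + j = r + 1 then 1 else 0))"

(* The existential quantifier expresses "the" reciprocal basis:
   b' is determined on {1..r} by b. *)
definition RKZ_reduced_basis :: "nat \<Rightarrow> (nat \<Rightarrow> 'a::euclidean_space) \<Rightarrow> 'a set \<Rightarrow> bool" where
  "RKZ_reduced_basis r b L \<longleftrightarrow> lattice_basis r b L \<and>
     (\<exists>b'. reciprocal_basis r b b' \<and> KZ_reduced_basis r b' (reciprocal_lattice L))"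


section \<open>Nullspace reformulation\<close>

definition null_lattice :: "int^'n^'m \<Rightarrow> (real^'n) set" where
  "null_lattice A = real_vec ` {x. A *v x = 0}"

(* Points of R^r are the extensional real functions on {1..r}; B i is the i-th column. *)
definition Q_N :: "nat \<Rightarrow> (nat \<Rightarrow> real^'n) \<Rightarrow> int^'n \<Rightarrow> (nat \<Rightarrow> real) set" where
  "Q_N r B x0 = {y \<in> {1..r} \<rightarrow>\<^sub>E UNIV.
     \<forall>k. - real_of_int (x0 $ k) \<le> (\<Sum>i\<in>{1..r}. y i *\<^sub>R B i) $ k \<and>
         (\<Sum>i\<in>{1..r}. y i *\<^sub>R B i) $ k \<le> 1 - real_of_int (x0 $ k)}"

definition RKZ_nullspace_reformulation ::
    "int^'n^'m \<Rightarrow> int^'m \<Rightarrow> (nat \<Rightarrow> real) set \<Rightarrow> bool" where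
  "RKZ_nullspace_reformulation A b Q \<longleftrightarrow>
     (\<exists>B x0. RKZ_reduced_basis (CARD('n) - CARD('m)) B (null_lattice A) \<and> A *v x0 = b \<and>
             Q = Q_N (CARD('n) - CARD('m)) B x0)"


section \<open>Reverse branch-and-bound\<close>

(* The two existential conditions say min \<le> g \<le> max for the coordinate y_i on P,
   with min = -\<infinity> or max = \<infinity> when P is unbounded in that direction;
   there is no node when P is empty. *)
definition branch :: "nat \<Rightarrow> (nat \<Rightarrow> real) set \<Rightarrow> (nat \<Rightarrow> real) set set" where
  "branch i P = {P \<inter> {y. y i = real_of_int g} | g :: int.
     (\<exists>y\<in>P. y i \<le> real_of_int g) \<and> (\<exists>y\<in>P. real_of_int g \<le> y i)}"

(* The subproblems after branching on y_r, ..., y_{r-k+1}; for k \<ge> 1 they form the level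
   of y_{r-k+1}. For convex P all nodes are nonempty and the nodes of a level are pairwise
   disjoint, so a level may be represented as a set of polyhedra. *)
primrec bb_nodes :: "nat \<Rightarrow> (nat \<Rightarrow> real) set \<Rightarrow> nat \<Rightarrow> (nat \<Rightarrow> real) set set" where
  "bb_nodes r P 0 = {P}"
| "bb_nodes r P (Suc k) = (\<Union>P'\<in>bb_nodes r P k. branch (r - k) P')"

(* The tree is generated in full: a node counts as an integral point found only after y_1
   has been branched on. A solver that recognises an integral point earlier generates
   a subset of these nodes. *)
definition solves_at_rootnode :: "nat \<Rightarrow> (nat \<Rightarrow> real) set \<Rightarrow> bool" where
  "solves_at_rootnode r P \<longleftrightarrow>
     (\<forall>k\<in>{1..r}. finite (bb_nodes r P k) \<and> card (bb_nodes r P k) \<le> 1)"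

definition always_solved_at_rootnode :: "int^'n^'m \<Rightarrow> bool" where
  "always_solved_at_rootnode A \<longleftrightarrow>
     (\<forall>b Q. RKZ_nullspace_reformulation A b Q \<longrightarrow>
            solves_at_rootnode (CARD('n) - CARD('m)) Q)"

end

theory Submission
  imports Defs
begin

text \<open>If all Gram-Schmidt vectors of the columns of \<open>B\<close> are longer than \<open>sqrt n\<close>, then, once the later
  variables are fixed, each \<open>y i\<close> varies over \<open>Q_N\<close> in an interval of length below \<open>1\<close>, so every level has at
  most one node. For an RKZ reduced basis, Minkowski's theorem applied to the lattice spanned by
  \<open>b 1, \<dots>, b i\<close> and to its reciprocal shows that the \<open>i\<close>-th Gram-Schmidt vector has length at least the
  length of the shortest nonzero kernel vector divided by \<open>1 + i / 4\<close>. So only matrices that annihilate a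
  nonzero integer vector of norm at most \<open>sqrt n * (1 + (n - m) / 4)\<close> can fail. They are counted by a union
  bound: a primitive vector with an entry of absolute value \<open>c\<close> is orthogonal to a random row with
  probability at most \<open>(M + c - 1) / (c * M\<^sup>2)\<close>. The factor \<open>c\<close> gained over the trivial bound
  \<open>1 / M\<close> is what makes Minkowski's bound on the Hermite constant sufficient.\<close>

text \<open>The lattices at hand have rank \<open>i\<close> inside a larger space, so volumes are
  taken in coordinates: along the normalized Gram-Schmidt vectors a basis becomes a triangular
  matrix with the Gram-Schmidt norms on its diagonal. Minkowski's theorem is then a statement about
  Lebesgue measure on coordinate space, the determinant is a plain product, and projected lattices
  are covered by the same statement. The union bound is taken over \<open>mat_G\<close>, whose rows
  range independently; the hypothesis on \<open>mat_chi\<close> costs a factor 2 on passing to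
  \<open>mat_G'\<close>. Two classes of kernel vectors, each contributing at most 1 / d, thus give a
  failure rate of at most 4 / d.\<close>

section \<open>Minkowski's theorem for triangular bases\<close>

text \<open>A measure that agrees with the product on boxes is the product, and on a box the
  translation acts factor by factor. This brings pieces of the ball back into the fundamental box
  without change of measure.\<close>

lemma PiM_lborel_translate:
  fixes v :: "'i \<Rightarrow> real"
  assumes "finite I"
  shows "distr (Pi\<^sub>M I (\<lambda>_. lborel)) (Pi\<^sub>M I (\<lambda>_. lborel)) (\<lambda>f. \<lambda>i\<in>I. f i + v i) = Pi\<^sub>M I (\<lambda>_. lborel)"
proof -
  interpret product_sigma_finite "\<lambda>_. lborel :: real measure" by standard
  have meas [measurable]: "(\<lambda>f. \<lambda>i\<in>I. f i + v i) \<in> Pi\<^sub>M I (\<lambda>_. lborel) \<rightarrow>\<^sub>M Pi\<^sub>M I (\<lambda>_. lborel)"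
    by measurable
  show ?thesis
  proof (rule PiM_eqI[OF assms])
    fix A :: "'i \<Rightarrow> real set" assume A: "\<And>i. i \<in> I \<Longrightarrow> A i \<in> sets lborel"
    define B where "B i = (\<lambda>x. x + v i) -` A i" for i
    have B: "B i \<in> sets lborel" if "i \<in> I" for i
    proof -
      have "(\<lambda>x. x + v i) \<in> borel \<rightarrow>\<^sub>M borel" by measurable
      from measurable_sets[OF this, of "A i"] A[OF that] show ?thesis by (simp add: B_def)
    qed
    have eq: "(\<lambda>f. \<lambda>i\<in>I. f i + v i) -` Pi\<^sub>E I A \<inter> space (Pi\<^sub>M I (\<lambda>_. lborel)) = Pi\<^sub>E I B"
      by (auto simp: space_PiM B_def PiE_def Pi_def extensional_def)
    have "emeasure (distr (Pi\<^sub>M I (\<lambda>_. lborel)) (Pi\<^sub>M I (\<lambda>_. lborel)) (\<lambda>f. \<lambda>i\<in>I. f i + v i)) (Pi\<^sub>E I A)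
        = emeasure (Pi\<^sub>M I (\<lambda>_. lborel)) (Pi\<^sub>E I B)"
      using A assms by (subst emeasure_distr) (auto simp: eq intro!: sets_PiM_I_finite)
    also have "\<dots> = (\<Prod>i\<in>I. emeasure lborel (B i))"
      using B assms by (intro emeasure_PiM) auto
    also have "\<dots> = (\<Prod>i\<in>I. emeasure lborel (A i))"
    proof (rule prod.cong[OF refl])
      fix i assume i: "i \<in> I"
      have "emeasure lborel (A i) = emeasure (distr lborel borel ((+) (v i))) (A i)"
        by (simp add: lborel_distr_plus)
      also have "\<dots> = emeasure lborel (B i)"
        using A[OF i] by (subst emeasure_distr) (auto simp: B_def vimage_def add.commute)
      finally show "emeasure lborel (B i) = emeasure lborel (A i)" ..
    qed
    finally show "emeasure (distr (Pi\<^sub>M I (\<lambda>_. lborel)) (Pi\<^sub>M I (\<lambda>_. lborel)) (\<lambda>f. \<lambda>i\<in>I. f i + v i)) (Pi\<^sub>E I A)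
        = (\<Prod>i\<in>I. emeasure lborel (A i))" .
  qed simp
qed

text \<open>Greedy reduction from the largest index down: row \<open>b\<close> settles coordinate
  \<open>b\<close> by a floor division, and the rows of smaller index vanish there, so they cannot
  disturb it. Hence the lattice translates of the half-open box cover the space.\<close>

lemma triangular_lattice_reduction:
  fixes h :: "'i::linorder \<Rightarrow> real" and C :: "'i \<Rightarrow> 'i \<Rightarrow> real"
  assumes "finite I" and "\<And>k. k \<in> I \<Longrightarrow> h k > 0" and "\<And>k. k \<in> I \<Longrightarrow> C k k = h k"
    and "\<And>k l. k \<in> I \<Longrightarrow> l \<in> I \<Longrightarrow> k < l \<Longrightarrow> C k l = 0"
  shows "\<exists>z :: 'i \<Rightarrow> int. \<forall>l\<in>I. f l - (\<Sum>k\<in>I. of_int (z k) * C k l) \<in> {0..<h l}"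
  using assms
proof (induction I arbitrary: f rule: finite_linorder_max_induct)
  case empty
  then show ?case by simp
next
  case (insert b A)
  define q where "q = \<lfloor>f b / h b\<rfloor>"
  have hb: "h b > 0" using insert by simp
  have "\<exists>z :: 'i \<Rightarrow> int. \<forall>l\<in>A. (f l - of_int q * C b l) - (\<Sum>k\<in>A. of_int (z k) * C k l) \<in> {0..<h l}"
    using insert.prems by (intro insert.IH) auto
  then obtain z :: "'i \<Rightarrow> int" where
    z: "\<And>l. l \<in> A \<Longrightarrow> (f l - of_int q * C b l) - (\<Sum>k\<in>A. of_int (z k) * C k l) \<in> {0..<h l}" by blast
  have bA: "b \<notin> A" using insert.hyps by auto
  have sumeq: "(\<Sum>k\<in>insert b A. of_int ((z(b := q)) k) * C k l)
      = of_int q * C b l + (\<Sum>k\<in>A. of_int (z k) * C k l)" for l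
  proof -
    have "(\<Sum>k\<in>A. of_int ((z(b := q)) k) * C k l) = (\<Sum>k\<in>A. of_int (z k) * C k l)"
      using bA by (intro sum.cong) auto
    then show ?thesis using bA insert.hyps(1) by simp
  qed
  show ?case
  proof (intro exI ballI)
    fix l assume l: "l \<in> insert b A"
    show "f l - (\<Sum>k\<in>insert b A. of_int ((z(b := q)) k) * C k l) \<in> {0..<h l}"
    proof (cases "l = b")
      case True
      have "(\<Sum>k\<in>A. of_int (z k) * C k b) = 0"
        using insert.prems(3) insert.hyps(2) by (intro sum.neutral) auto
      moreover have "of_int q * h b \<le> f b" "f b < of_int q * h b + h b"
        using floor_divide_lower[OF hb, of "f b"] floor_divide_upper[OF hb, of "f b"]
        by (auto simp: q_def algebra_simps)
      ultimately show ?thesis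
        using insert.prems(2)[of b] unfolding sumeq by (simp add: True)
    next
      case False
      with z[of l] l show ?thesis unfolding sumeq by (simp add: algebra_simps)
    qed
  qed
qed

text \<open>Each point is kept only in the piece that comes first in an enumeration of
  \<open>I\<close>, which makes the pieces disjoint. The indices will be integer coefficient
  vectors.\<close>

lemma emeasure_UN_countable_subadditive:
  assumes "\<And>i. i \<in> I \<Longrightarrow> X i \<in> sets M" and I: "countable I"
  shows "emeasure M (\<Union>i\<in>I. X i) \<le> (\<integral>\<^sup>+i. emeasure M (X i) \<partial>count_space I)"
proof -
  define g where "g = to_nat_on I"
  have g: "inj_on g I" unfolding g_def using I by (rule inj_on_to_nat_on)
  define Y where "Y i = X i - (\<Union>j\<in>{j \<in> I. g j < g i}. X j)" for i
  have "(\<Union>i\<in>I. X i) \<subseteq> (\<Union>i\<in>I. Y i)"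
  proof
    fix x assume "x \<in> (\<Union>i\<in>I. X i)"
    then obtain i where "i \<in> I \<and> x \<in> X i" "\<And>j. j \<in> I \<and> x \<in> X j \<Longrightarrow> g i \<le> g j"
      using ex_has_least_nat[of "\<lambda>i. i \<in> I \<and> x \<in> X i" _ g] by blast
    then have "i \<in> I" "x \<in> Y i" unfolding Y_def by (auto simp: not_less[symmetric])
    then show "x \<in> (\<Union>i\<in>I. Y i)" by blast
  qed
  then have eq: "(\<Union>i\<in>I. X i) = (\<Union>i\<in>I. Y i)" by (auto simp: Y_def)
  have "Y i \<in> sets M" if "i \<in> I" for i
    unfolding Y_def using assms that by (intro sets.Diff sets.countable_UN') auto
  moreover have "disjoint_family_on Y I"
    unfolding disjoint_family_on_def
  proof (intro ballI impI)
    fix i j assume "i \<in> I" "j \<in> I" "i \<noteq> j"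
    then have "g i < g j \<or> g j < g i" using g by (metis inj_onD linorder_neqE_nat)
    then show "Y i \<inter> Y j = {}" using \<open>i \<in> I\<close> \<open>j \<in> I\<close> by (auto simp: Y_def)
  qed
  ultimately have "emeasure M (\<Union>i\<in>I. X i) = (\<integral>\<^sup>+i. emeasure M (Y i) \<partial>count_space I)"
    unfolding eq using I by (intro emeasure_UN_countable) auto
  also have "\<dots> \<le> (\<integral>\<^sup>+i. emeasure M (X i) \<partial>count_space I)"
    using assms by (intro nn_integral_mono emeasure_mono) (auto simp: Y_def)
  finally show ?thesis .
qed

text \<open>Blichfeldt's argument: the translates of the fundamental box that meet the ball of radius
  \<open>\<rho> / 2\<close>, moved back into the box, cannot all be disjoint.\<close>

lemma minkowski_triangular:
  fixes h :: "'i::linorder \<Rightarrow> real" and C :: "'i \<Rightarrow> 'i \<Rightarrow> real"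
  assumes fin: "finite I" and h: "\<And>k. k \<in> I \<Longrightarrow> h k > 0" and diag: "\<And>k. k \<in> I \<Longrightarrow> C k k = h k"
    and tri: "\<And>k l. k \<in> I \<Longrightarrow> l \<in> I \<Longrightarrow> k < l \<Longrightarrow> C k l = 0"
    and "\<rho> > 0" and vol: "unit_ball_vol (card I) * \<rho> ^ card I > 2 ^ card I * (\<Prod>k\<in>I. h k)"
  shows "\<exists>z :: 'i \<Rightarrow> int. (\<exists>k\<in>I. z k \<noteq> 0) \<and> (\<Sum>l\<in>I. (\<Sum>k\<in>I. of_int (z k) * C k l)\<^sup>2) \<le> \<rho>\<^sup>2"
proof (rule ccontr)
  assume no: "\<not> ?thesis"
  interpret product_sigma_finite "\<lambda>_. lborel :: real measure" by standard
  let ?P = "Pi\<^sub>M I (\<lambda>_. lborel :: real measure)"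
  define v where "v z l = (\<Sum>k\<in>I. of_int (z k) * C k l)" for z :: "'i \<Rightarrow> int" and l
  define S where "S = {f. sqrt (\<Sum>i\<in>I. (f i)\<^sup>2) \<le> \<rho> / 2} \<inter> space ?P"
  define box where "box = (\<Pi>\<^sub>E l\<in>I. {0..<h l})"
  define t where "t z f = (\<lambda>i\<in>I. f i + v z i)" for z :: "'i \<Rightarrow> int" and f
  \<comment> \<open>Coefficient vectors are made extensional, so that agreement on \<open>I\<close>
    is equality; the disjointness argument ends with that.\<close>
  define Z where "Z = (\<Pi>\<^sub>E k\<in>I. (UNIV :: int set))"
  define D where "D z = box \<inter> t z -` S" for z
  have Z: "countable Z" unfolding Z_def using fin by (intro countable_PiE) auto
  have S_meas [measurable]: "S \<in> sets ?P"
    unfolding S_def by measurable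
  have box_meas [measurable]: "box \<in> sets ?P"
    unfolding box_def using fin by (intro sets_PiM_I_finite) auto
  have box_space: "box \<subseteq> space ?P" by (rule sets.sets_into_space) measurable
  have t_meas [measurable]: "t z \<in> ?P \<rightarrow>\<^sub>M ?P" for z unfolding t_def by measurable
  have D_eq: "D z = box \<inter> (t z -` S \<inter> space ?P)" for z using box_space by (auto simp: D_def)
  have D_meas: "D z \<in> sets ?P" for z unfolding D_eq by measurable
  have cover: "S \<subseteq> (\<Union>z\<in>Z. S \<inter> t z ` box)"
  proof
    fix f assume f: "f \<in> S"
    have "\<exists>z :: 'i \<Rightarrow> int. \<forall>l\<in>I. f l - (\<Sum>k\<in>I. of_int (z k) * C k l) \<in> {0..<h l}"
      by (rule triangular_lattice_reduction) (use fin h diag tri in auto)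
    then obtain z0 :: "'i \<Rightarrow> int"
      where z0: "\<And>l. l \<in> I \<Longrightarrow> f l - (\<Sum>k\<in>I. of_int (z0 k) * C k l) \<in> {0..<h l}" by blast
    define z where "z = restrict z0 I"
    have vz: "v z l = (\<Sum>k\<in>I. of_int (z0 k) * C k l)" for l
      unfolding v_def z_def by (intro sum.cong) auto
    have "(\<lambda>l\<in>I. f l - v z l) \<in> box" using z0 by (auto simp: box_def vz)
    moreover have "t z (\<lambda>l\<in>I. f l - v z l) = f"
      using f by (auto simp: t_def S_def space_PiM PiE_def extensional_def)
    moreover have "z \<in> Z" by (auto simp: z_def Z_def)
    ultimately show "f \<in> (\<Union>z\<in>Z. S \<inter> t z ` box)" using f by force
  qed
  \<comment> \<open>If one box point is moved into the ball of radius \<open>\<rho> / 2\<close> by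
    two lattice vectors, their difference is a lattice vector of norm at most \<open>\<rho>\<close>;
    by \<open>no\<close> its coefficients vanish.\<close>
  have inj: "z = z'" if z: "z \<in> Z" "z' \<in> Z" and meet: "D z \<inter> D z' \<noteq> {}" for z z'
  proof -
    obtain f where f: "t z f \<in> S" "t z' f \<in> S" using meet by (auto simp: D_def)
    define w where "w = (\<lambda>k. z k - z' k)"
    have vw: "v w l = v z l - v z' l" for l
      by (simp add: v_def w_def sum_subtractf algebra_simps)
    have nS: "L2_set (t z f) I \<le> \<rho> / 2" "L2_set (\<lambda>i. - t z' f i) I \<le> \<rho> / 2"
      using f by (auto simp: S_def L2_set_def)
    have "L2_set (v w) I = L2_set (\<lambda>i. t z f i + - t z' f i) I"
      by (rule L2_set_cong) (auto simp: vw t_def)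
    also have "\<dots> \<le> \<rho>" using L2_set_triangle_ineq[of "t z f" "\<lambda>i. - t z' f i" I] nS by simp
    finally have "(\<Sum>l\<in>I. (v w l)\<^sup>2) \<le> \<rho>\<^sup>2"
      unfolding L2_set_def by (rule sqrt_le_D)
    with no have "\<forall>k\<in>I. w k = 0" unfolding v_def by blast
    then show ?thesis using z unfolding Z_def w_def by (intro PiE_ext[of z I _ z']) auto
  qed
  \<comment> \<open>The part of the ball covered by translate \<open>z\<close> is \<open>D z\<close>
    shifted by \<open>v z\<close>, so both have the same measure. The sets \<open>D z\<close> are
    disjoint in the box, hence the ball is no larger than the box.\<close>
  have piece: "S \<inter> t z ` box \<in> sets ?P \<and> emeasure ?P (S \<inter> t z ` box) = emeasure ?P (D z)" for z
  proof -
    let ?u = "\<lambda>f. \<lambda>i\<in>I. f i + - v z i"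
    have u_meas: "?u \<in> ?P \<rightarrow>\<^sub>M ?P" by measurable
    have "S \<inter> t z ` box = ?u -` D z \<inter> space ?P"
    proof (intro equalityI subsetI)
      fix f assume "f \<in> S \<inter> t z ` box"
      then obtain g where g: "g \<in> box" "f = t z g" "f \<in> S" by auto
      then have "?u f = g" by (auto simp: t_def box_def PiE_def extensional_def)
      with g show "f \<in> ?u -` D z \<inter> space ?P" by (auto simp: D_def S_def)
    next
      fix f assume f: "f \<in> ?u -` D z \<inter> space ?P"
      then have "t z (?u f) = f" by (auto simp: t_def space_PiM PiE_def extensional_def)
      with f show "f \<in> S \<inter> t z ` box" by (force simp: D_def)
    qed
    moreover have "emeasure ?P (?u -` D z \<inter> space ?P) = emeasure ?P (D z)"
      using emeasure_distr[OF u_meas D_meas[of z]]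
      unfolding PiM_lborel_translate[OF fin, of "\<lambda>i. - v z i"] by simp
    ultimately show ?thesis using measurable_sets[OF u_meas D_meas[of z]] by simp
  qed
  have "emeasure ?P S \<le> emeasure ?P (\<Union>z\<in>Z. S \<inter> t z ` box)"
    using cover piece Z by (intro emeasure_mono sets.countable_UN') auto
  also have "\<dots> \<le> (\<integral>\<^sup>+z. emeasure ?P (S \<inter> t z ` box) \<partial>count_space Z)"
    using piece Z by (intro emeasure_UN_countable_subadditive) auto
  also have "\<dots> = (\<integral>\<^sup>+z. emeasure ?P (D z) \<partial>count_space Z)"
    using piece by simp
  also have "\<dots> = emeasure ?P (\<Union>z\<in>Z. D z)"
  proof (rule emeasure_UN_countable[symmetric])
    show "disjoint_family_on D Z" unfolding disjoint_family_on_def using inj by blast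
  qed (use D_meas Z in auto)
  also have "\<dots> \<le> emeasure ?P box"
    by (intro emeasure_mono) (auto simp: D_def)
  also have "\<dots> = (\<Prod>l\<in>I. ennreal (h l))"
    unfolding box_def using fin h by (subst emeasure_PiM) (auto intro!: prod.cong simp: less_imp_le)
  also have "\<dots> = ennreal (\<Prod>l\<in>I. h l)"
    using h by (intro prod_ennreal) (auto simp: less_imp_le)
  finally have "emeasure ?P S \<le> ennreal (\<Prod>l\<in>I. h l)" .
  moreover have "emeasure ?P S = ennreal (unit_ball_vol (card I) * (\<rho> / 2) ^ card I)"
    unfolding S_def using emeasure_cball_aux[OF fin, of "\<rho> / 2"] \<open>\<rho> > 0\<close> by simp
  ultimately have "unit_ball_vol (card I) * (\<rho> / 2) ^ card I \<le> (\<Prod>l\<in>I. h l)"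
    using h by (simp add: prod_nonneg less_imp_le)
  then show False using vol by (simp add: field_simps)
qed

section \<open>Unit balls in dimension at most 30\<close>

text \<open>Since \<open>sin (pi / 6)\<close> is 1 / 2 and \<open>sin\<close> is increasing there,
  it suffices to compare degree 5 Taylor polynomials with 1 / 2 at one sixth of each bound. The
  lower bound is just enough for \<open>pi\<^sup>2 > 9.85\<close>; the upper one is 63 / 20, the
  rational used in the final count.\<close>

lemma pi_bounds: "3.1385 < pi" "pi < 3.15"
proof -
  have S: "(\<Sum>m<6. sin_coeff m * x ^ m) = x - x ^ 3 / 6 + x ^ 5 / 120" for x :: real
    by (simp add: sin_coeff_def lessThan_nat_numeral fact_numeral)
  have "sin (3.1385 / 6 :: real) < 1 / 2"
    using Maclaurin_sin_bound[of "3.1385 / 6" 6] unfolding S abs_le_iff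
    by (simp add: fact_numeral power_numeral_reduce)
  also have "\<dots> = sin (pi / 6)" by (simp add: sin_30)
  finally show "3.1385 < pi"
    using sin_monotone_2pi_le[of "pi / 6" "3.1385 / 6"] pi_gt_zero pi_ge_two by (auto simp: not_less[symmetric])
  have "sin (pi / 6) = 1 / 2" by (simp add: sin_30)
  also have "\<dots> < sin (3.15 / 6 :: real)"
    using Maclaurin_sin_bound[of "3.15 / 6" 6] unfolding S abs_le_iff
    by (simp add: fact_numeral power_numeral_reduce)
  finally have *: "sin (pi / 6) < sin (3.15 / 6 :: real)" .
  show "pi < 3.15"
  proof (rule ccontr)
    assume "\<not> pi < 3.15"
    then have "sin (3.15 / 6) \<le> sin (pi / 6)"
      using pi_ge_two by (intro sin_monotone_2pi_le) simp_all
    with * show False by simp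
  qed
qed

text \<open>The functional equation of \<open>Gamma\<close>. Steps of two dimensions treat even and
  odd dimensions alike and bring in only integral powers of \<open>pi\<close>.\<close>

lemma unit_ball_vol_rec: "unit_ball_vol (real (n + 2)) = 2 * pi / real (n + 2) * unit_ball_vol (real n)"
proof -
  have "Gamma (real n / 2 + 1 + 1) = (real n / 2 + 1) * Gamma (real n / 2 + 1)"
    by (rule Gamma_plus1) (auto simp: nonpos_Ints_def)
  then have G: "Gamma (real (n + 2) / 2 + 1) = (real n / 2 + 1) * Gamma (real n / 2 + 1)"
    by (simp add: add_divide_distrib)
  have "pi powr (real (n + 2) / 2) = pi * pi powr (real n / 2)"
    by (simp add: add_divide_distrib powr_add)
  then show ?thesis unfolding unit_ball_vol_def G by (simp add: field_simps)
qed

text \<open>In other words \<open>4 / V powr (2 / i) < 1 + i / 4\<close> for the volume \<open>V\<close> of the unit ball: Minkowski's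
  bound on the Hermite constant is below \<open>1 + i / 4\<close>.\<close>

lemma unit_ball_vol_lower_bound:
  assumes "0 < i" "i \<le> 30"
  shows "16 ^ i < (unit_ball_vol (real i))\<^sup>2 * (4 + real i) ^ i"
proof -
  define F where "F i = (unit_ball_vol (real i))\<^sup>2 * (4 + real i) ^ i / 16 ^ i" for i
  have pi2: "pi\<^sup>2 > 9.85"
  proof -
    have "(3.1385 :: real)\<^sup>2 < pi\<^sup>2" using pi_bounds by (intro power_strict_mono) auto
    then show ?thesis by (simp add: power2_eq_square)
  qed
  \<comment> \<open>The ratio \<open>F (i + 2) / F i\<close> is \<open>4 * pi\<^sup>2 * (6 + i) ^ (i
    + 2) / (256 * (i + 2) ^ 2 * (4 + i) ^ i)\<close>. As 39.4 is 4 * 9.85, the condition is free of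
    \<open>pi\<close> and can be evaluated for each dimension.\<close>
  have step: "F i < F (i + 2)" if "256 * real (i + 2) ^ 2 * (4 + real i) ^ i \<le> 39.4 * (6 + real i) ^ (i + 2)" for i
  proof -
    let ?V = "unit_ball_vol (real i)"
    have "39.4 * (6 + real i) ^ (i + 2) < 4 * pi\<^sup>2 * (6 + real i) ^ (i + 2)"
      using pi2 by (intro mult_strict_right_mono) auto
    with that have "256 * real (i + 2) ^ 2 * (4 + real i) ^ i < 4 * pi\<^sup>2 * (6 + real i) ^ (i + 2)"
      by (rule order.strict_trans1)
    then have "(4 + real i) ^ i < 4 * pi\<^sup>2 * (6 + real i) ^ (i + 2) / (256 * real (i + 2) ^ 2)"
      by (simp add: pos_less_divide_eq mult_ac)
    then have "?V\<^sup>2 * (4 + real i) ^ i / 16 ^ i <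
        ?V\<^sup>2 * (4 * pi\<^sup>2 * (6 + real i) ^ (i + 2) / (256 * real (i + 2) ^ 2)) / 16 ^ i"
      by (intro divide_strict_right_mono mult_strict_left_mono) (auto simp: less_imp_neq[THEN not_sym])
    also have "\<dots> = F (i + 2)"
      unfolding F_def unit_ball_vol_rec by (simp add: field_simps power2_eq_square power_add)
    finally show ?thesis by (simp add: F_def)
  qed
  have "1 < F i"
    using assms
  proof (induction i rule: less_induct)
    case (less i)
    consider "i = 1" | "i = 2" | "i > 2" using less.prems by linarith
    then show ?case
    proof cases
      case 1
      then show ?thesis by (simp add: F_def)
    next
      case 2
      then show ?thesis using pi2 by (simp add: F_def unit_ball_vol_2)
    next
      case 3
      define j where "j = i - 2"
      have j: "i = j + 2" "0 < j" "j \<le> 28" using 3 less.prems by (auto simp: j_def)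
      have "\<forall>j\<in>{..<29}. 256 * real (j + 2) ^ 2 * (4 + real j) ^ j \<le> 39.4 * (6 + real j) ^ (j + 2)"
        by (simp add: lessThan_nat_numeral)
      with j have "256 * real (j + 2) ^ 2 * (4 + real j) ^ j \<le> 39.4 * (6 + real j) ^ (j + 2)"
        by auto
      from step[OF this] less.IH[of j] j show ?thesis by simp
    qed
  qed
  then show ?thesis by (simp add: F_def field_simps)
qed

section \<open>Gram-Schmidt vectors of RKZ reduced bases\<close>

text \<open>Pythagoras turns the nearest-point definition into the usual pair of conditions:
  orthogonality to the earlier vectors and agreement with \<open>b i\<close> modulo their span. All
  other facts about \<open>gso\<close> are derived through it.\<close>

lemma gso_unique:
  assumes "\<And>w. w \<in> span (b ` {1..<i}) \<Longrightarrow> w \<bullet> v = 0" and "b i - v \<in> span (b ` {1..<i})"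
  shows "gso b i = v"
proof -
  let ?S = "orthogonal_comp (span (b ` {1..<i}))"
  have v: "v \<in> ?S" using assms(1) by (auto simp: orthogonal_comp_def orthogonal_def)
  have "dist (b i) v \<le> dist (b i) z" if "z \<in> ?S" for z
  proof -
    have "v - z \<in> ?S" using v that subspace_orthogonal_comp by (rule subspace_diff[rotated])
    then have "orthogonal (b i - v) (v - z)" using assms(2) by (auto simp: orthogonal_comp_def)
    then have "(norm ((b i - v) + (v - z)))\<^sup>2 = (norm (b i - v))\<^sup>2 + (norm (v - z))\<^sup>2"
      by (rule norm_add_Pythagorean)
    then have "(norm (b i - v))\<^sup>2 \<le> (norm (b i - z))\<^sup>2" by simp
    then show ?thesis by (simp add: dist_norm)
  qed
  then have "v = closest_point ?S (b i)"
    using v subspace_orthogonal_comp by (intro closest_point_unique subspace_imp_convex closed_subspace) auto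
  then show ?thesis by (simp add: gso_def)
qed

lemma
  shows gso_orthogonal: "w \<in> span (b ` {1..<i}) \<Longrightarrow> w \<bullet> gso b i = 0"
    and gso_diff_in_span: "b i - gso b i \<in> span (b ` {1..<i})"
proof -
  obtain y z where yz: "y \<in> span (b ` {1..<i})" "\<And>w. w \<in> span (b ` {1..<i}) \<Longrightarrow> orthogonal z w" "b i = y + z"
    using orthogonal_subspace_decomp_exists[of "b ` {1..<i}" "b i"] by blast
  have "gso b i = z"
    by (rule gso_unique) (use yz in \<open>auto simp: orthogonal_def inner_commute\<close>)
  with yz show "w \<in> span (b ` {1..<i}) \<Longrightarrow> w \<bullet> gso b i = 0" "b i - gso b i \<in> span (b ` {1..<i})"
    by (auto simp: orthogonal_def inner_commute)
qed

lemma gso_in_span: "1 \<le> i \<Longrightarrow> gso b i \<in> span (b ` {1..i})"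
proof -
  assume "1 \<le> i"
  then have "b i \<in> span (b ` {1..i})" by (intro span_base) auto
  moreover have "b i - gso b i \<in> span (b ` {1..i})"
    using gso_diff_in_span[of b i] span_mono[of "b ` {1..<i}" "b ` {1..i}"] by fastforce
  ultimately have "b i - (b i - gso b i) \<in> span (b ` {1..i})" by (rule span_diff)
  then show ?thesis by simp
qed

lemma inner_gso_lower: "1 \<le> j \<Longrightarrow> j < i \<Longrightarrow> b j \<bullet> gso b i = 0"
  by (intro gso_orthogonal span_base) auto

lemma inner_gso_gso:
  assumes "1 \<le> i" "1 \<le> j" "i \<noteq> j"
  shows "gso b i \<bullet> gso b j = 0"
proof -
  have *: "gso b i \<bullet> gso b j = 0" if "1 \<le> i" "i < j" for i j
    using gso_in_span[OF that(1), of b] span_mono[of "b ` {1..i}" "b ` {1..<j}"] that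
    by (intro gso_orthogonal) force
  show ?thesis using *[of i j] *[of j i] assms by (cases "i < j") (auto simp: inner_commute)
qed

lemma inner_gso_self: "b i \<bullet> gso b i = gso b i \<bullet> gso b i"
  using gso_orthogonal[OF gso_diff_in_span, of b i] by (simp add: inner_diff_left)

lemma span_gso: "span (gso b ` {1..<i}) = span (b ` {1..<i})"
proof (induction i)
  case (Suc i)
  show ?case
  proof (cases "i = 0")
    case False
    then have eq: "{1..<Suc i} = insert i {1..<i}" by auto
    have "gso b i - b i \<in> span (b ` {1..<i})"
      using span_neg[OF gso_diff_in_span[of b i]] by simp
    then have "span (insert (gso b i) (b ` {1..<i})) = span (insert (b i) (b ` {1..<i}))"
      by (rule eq_span_insert_eq)
    moreover have "span (insert (gso b i) (gso b ` {1..<i})) = span (insert (gso b i) (b ` {1..<i}))"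
      by (simp only: span_insert Suc.IH)
    ultimately show ?thesis by (simp only: eq image_insert)
  qed simp
qed simp

lemma gso_nonzero:
  assumes "inj_on b {1..r}" "independent (b ` {1..r})" "i \<in> {1..r}"
  shows "gso b i \<noteq> 0"
proof
  assume "gso b i = 0"
  then have "b i \<in> span (b ` {1..<i})" using gso_diff_in_span[of b i] by simp
  also have "\<dots> \<subseteq> span (b ` {1..r} - {b i})"
  proof (intro span_mono subsetI)
    fix v assume "v \<in> b ` {1..<i}"
    then obtain k where k: "v = b k" "k \<in> {1..<i}" by blast
    then have "b k \<noteq> b i" using assms(3) inj_onD[OF assms(1), of k i] by auto
    with k assms(3) show "v \<in> b ` {1..r} - {b i}" by auto
  qed
  finally show False using assms(2,3) by (auto simp: dependent_def)
qed

section \<open>Minkowski's bound in terms of an orthogonal system\<close>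

lemma norm_orthogonal_expansion:
  fixes u :: "'i \<Rightarrow> 'a::euclidean_space"
  assumes fin: "finite I" and u: "\<And>i. i \<in> I \<Longrightarrow> u i \<noteq> 0"
    and orth: "\<And>i j. i \<in> I \<Longrightarrow> j \<in> I \<Longrightarrow> i \<noteq> j \<Longrightarrow> u i \<bullet> u j = 0"
    and x: "x \<in> span (u ` I)"
  shows "(norm x)\<^sup>2 = (\<Sum>l\<in>I. (x \<bullet> u l / norm (u l))\<^sup>2)"
proof -
  define y where "y = (\<Sum>l\<in>I. (x \<bullet> u l / (norm (u l))\<^sup>2) *\<^sub>R u l)"
  have "y \<in> span (u ` I)" unfolding y_def by (intro span_sum span_scale span_base) auto
  with x have xy: "x - y \<in> span (u ` I)" by (rule span_diff)
  have yu: "y \<bullet> u k = x \<bullet> u k" if k: "k \<in> I" for k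
  proof -
    have "y \<bullet> u k = (\<Sum>l\<in>I. (x \<bullet> u l / (norm (u l))\<^sup>2) * (u l \<bullet> u k))"
      by (simp add: y_def inner_sum_left)
    also have "\<dots> = (\<Sum>l\<in>{k}. (x \<bullet> u l / (norm (u l))\<^sup>2) * (u l \<bullet> u k))"
      using fin k orth by (intro sum.mono_neutral_right) auto
    also have "\<dots> = x \<bullet> u k" using u[OF k] by (simp add: power2_norm_eq_inner)
    finally show ?thesis .
  qed
  have "orthogonal (x - y) (x - y)"
    using yu by (intro orthogonal_to_span[OF xy]) (auto simp: orthogonal_def inner_diff_left)
  then have "x = y" by (simp add: orthogonal_self)
  then have "(norm x)\<^sup>2 = y \<bullet> x" by (simp add: power2_norm_eq_inner)
  also have "\<dots> = (\<Sum>l\<in>I. (x \<bullet> u l / norm (u l))\<^sup>2)"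
    by (simp add: y_def inner_sum_left inner_sum_right power_divide power2_eq_square inner_commute)
  finally show ?thesis .
qed

text \<open>The coordinates of \<open>c\<close> along the normalized \<open>u\<close> are triangular
  with diagonal \<open>norm (u k)\<close>. Generators and orthogonal vectors are kept separate so
  that both a basis and the projected vectors \<open>gso_tail\<close> can take the place of
  \<open>c\<close>.\<close>

lemma minkowski_lattice_gen:
  fixes u c :: "nat \<Rightarrow> 'a::euclidean_space"
  assumes fin: "finite I" and u: "\<And>i. i \<in> I \<Longrightarrow> u i \<noteq> 0"
    and orth: "\<And>i j. i \<in> I \<Longrightarrow> j \<in> I \<Longrightarrow> i \<noteq> j \<Longrightarrow> u i \<bullet> u j = 0"
    and tri: "\<And>k. k \<in> I \<Longrightarrow> c k - u k \<in> span (u ` {l \<in> I. l < k})"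
    and "t > 0" and min: "\<And>w. w \<in> lattice_gen I c \<Longrightarrow> w \<noteq> 0 \<Longrightarrow> t \<le> norm w"
  shows "unit_ball_vol (card I) * t ^ card I \<le> 2 ^ card I * (\<Prod>k\<in>I. norm (u k))"
proof (rule ccontr)
  assume "\<not> ?thesis"
  then have big: "2 ^ card I * (\<Prod>k\<in>I. norm (u k)) < unit_ball_vol (card I) * t ^ card I" by simp
  have diff: "(c k - u k) \<bullet> u l = 0" if "k \<in> I" "l \<in> I" "k \<le> l" for k l
  proof -
    have "orthogonal (u l) (c k - u k)"
      by (rule orthogonal_to_span[OF tri[OF that(1)]]) (use that orth in \<open>auto simp: orthogonal_def\<close>)
    then show ?thesis by (simp add: orthogonal_def inner_commute)
  qed
  define C where "C k l = c k \<bullet> u l / norm (u l)" for k l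
  have diag: "C k k = norm (u k)" if "k \<in> I" for k
  proof -
    have "c k \<bullet> u k = (norm (u k))\<^sup>2"
      using diff[of k k] that by (simp add: inner_diff_left power2_norm_eq_inner)
    then show ?thesis using u[OF that] by (simp add: C_def power2_eq_square)
  qed
  have upper: "C k l = 0" if "k \<in> I" "l \<in> I" "k < l" for k l
    using diff[of k l] orth[of k l] that by (simp add: C_def inner_diff_left)
  \<comment> \<open>Minkowski's theorem yields norm at most the radius, while \<open>min\<close>
    excludes only norms below \<open>t\<close>. The volume inequality is strict, so it survives for
    some radius \<open>\<rho>\<close> slightly below \<open>t\<close>.\<close>
  have "((\<lambda>\<rho>. unit_ball_vol (card I) * \<rho> ^ card I) \<longlongrightarrow> unit_ball_vol (card I) * t ^ card I) (at_left t)"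
    by (intro tendsto_intros)
  from order_tendstoD(1)[OF this big]
  have "\<forall>\<^sub>F \<rho> in at_left t. 2 ^ card I * (\<Prod>k\<in>I. norm (u k)) < unit_ball_vol (card I) * \<rho> ^ card I" .
  moreover have "\<forall>\<^sub>F \<rho> in at_left t. \<rho> \<in> {0<..<t}"
    using \<open>t > 0\<close> by (rule eventually_at_left_real)
  ultimately have "\<forall>\<^sub>F \<rho> in at_left t. \<rho> \<in> {0<..<t} \<and>
      2 ^ card I * (\<Prod>k\<in>I. norm (u k)) < unit_ball_vol (card I) * \<rho> ^ card I"
    by eventually_elim auto
  from eventually_happens'[OF trivial_limit_at_left_real this] obtain \<rho> where \<rho>: "0 < \<rho>" "\<rho> < t"
    "2 ^ card I * (\<Prod>k\<in>I. norm (u k)) < unit_ball_vol (card I) * \<rho> ^ card I"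
    by auto
  have "\<exists>z :: nat \<Rightarrow> int. (\<exists>k\<in>I. z k \<noteq> 0) \<and> (\<Sum>l\<in>I. (\<Sum>k\<in>I. of_int (z k) * C k l)\<^sup>2) \<le> \<rho>\<^sup>2"
    by (rule minkowski_triangular[where h = "\<lambda>k. norm (u k)"]) (use fin u diag upper \<rho> in auto)
  then obtain z :: "nat \<Rightarrow> int" where z: "\<exists>k\<in>I. z k \<noteq> 0"
    and le: "(\<Sum>l\<in>I. (\<Sum>k\<in>I. of_int (z k) * C k l)\<^sup>2) \<le> \<rho>\<^sup>2" by blast
  define w where "w = (\<Sum>k\<in>I. real_of_int (z k) *\<^sub>R c k)"
  have wu: "(\<Sum>k\<in>I. of_int (z k) * C k l) = w \<bullet> u l / norm (u l)" for l
    by (simp add: w_def C_def inner_sum_left sum_divide_distrib)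
  have c_span: "c k \<in> span (u ` I)" if "k \<in> I" for k
  proof -
    have "c k - u k \<in> span (u ` I)"
      using tri[OF that] span_mono[of "u ` {l \<in> I. l < k}" "u ` I"] by blast
    moreover have "u k \<in> span (u ` I)" using that by (intro span_base) auto
    ultimately have "(c k - u k) + u k \<in> span (u ` I)" by (rule span_add)
    then show ?thesis by simp
  qed
  have "w \<in> span (u ` I)" unfolding w_def by (intro span_sum span_scale c_span)
  with fin u orth have "(norm w)\<^sup>2 = (\<Sum>l\<in>I. (w \<bullet> u l / norm (u l))\<^sup>2)"
    by (rule norm_orthogonal_expansion)
  then have "(norm w)\<^sup>2 \<le> \<rho>\<^sup>2" using le unfolding wu by simp
  then have "norm w \<le> \<rho>" by (rule power2_le_imp_le) (use \<rho>(1) in simp)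
  moreover have "w \<noteq> 0"
  proof
    assume "w = 0"
    \<comment> \<open>At the largest index with a nonzero coefficient, only one term contributes to
      the coordinate of \<open>w\<close>, so it cannot cancel.\<close>
    define m where "m = Max {k \<in> I. z k \<noteq> 0}"
    have "m \<in> {k \<in> I. z k \<noteq> 0}" unfolding m_def using fin z by (intro Max_in) auto
    then have m: "m \<in> I" "z m \<noteq> 0" by auto
    have "k \<le> m" if "k \<in> I" "z k \<noteq> 0" for k unfolding m_def using fin that by (intro Max_ge) auto
    then have "real_of_int (z k) * C k m = 0" if "k \<in> I - {m}" for k
      using that upper[of k m] m by (cases "z k = 0") (auto simp: le_neq_implies_less)
    then have "(\<Sum>k\<in>I. of_int (z k) * C k m) = (\<Sum>k\<in>{m}. of_int (z k) * C k m)"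
      using fin m by (intro sum.mono_neutral_right) blast+
    also have "\<dots> = of_int (z m) * norm (u m)" using diag[OF m(1)] by simp
    finally have "(\<Sum>k\<in>I. of_int (z k) * C k m) = of_int (z m) * norm (u m)" .
    with m u show False unfolding wu by (simp add: \<open>w = 0\<close>)
  qed
  moreover have "w \<in> lattice_gen I c" unfolding w_def lattice_gen_def by blast
  ultimately show False using min[of w] \<rho>(2) by simp
qed

text \<open>The vector \<open>v\<close> lies in the span of \<open>b 1, ..., b i\<close>, hence is
  orthogonal to every \<open>b' l\<close> with \<open>l < r + 1 - i\<close>, whose partner
  \<open>b (r + 1 - l)\<close> has index above \<open>i\<close>. It has the same inner products with
  \<open>b 1, ..., b i\<close> as \<open>b' (r + 1 - i)\<close>, so expanding the difference in the
  dual basis leaves only such \<open>b' l\<close>. These are the two conditions of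
  \<open>gso_unique\<close>.\<close>

lemma reciprocal_basis_gso:
  fixes b b' :: "nat \<Rightarrow> 'a::euclidean_space"
  assumes b: "inj_on b {1..r}" "independent (b ` {1..r})" and rec: "reciprocal_basis r b b'" and i: "i \<in> {1..r}"
  shows "gso b' (r + 1 - i) = gso b i /\<^sub>R (norm (gso b i))\<^sup>2"
proof -
  define v where "v = gso b i /\<^sub>R (norm (gso b i))\<^sup>2"
  have dual: "b k \<bullet> b' l = (if k + l = r + 1 then 1 else 0)" if "k \<in> {1..r}" "l \<in> {1..r}" for k l
    using rec that by (auto simp: reciprocal_basis_def)
  have gen_span: "lattice_gen {1..r} b \<subseteq> span (b ` {1..r})"
    by (clarsimp simp: lattice_gen_def) (intro span_sum span_scale span_base imageI)
  have b'_span: "b' l \<in> span (b ` {1..r})" if "l \<in> {1..r}" for l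
  proof -
    have "(\<Sum>k\<in>{1..r}. real_of_int (if k = l then 1 else 0) *\<^sub>R b' k) = (\<Sum>k\<in>{1..r}. if k = l then b' k else 0)"
      by (intro sum.cong) auto
    also have "\<dots> = b' l" using that by simp
    finally have "b' l \<in> lattice_gen {1..r} b'"
      unfolding lattice_gen_def mem_Collect_eq by (intro exI[of _ "\<lambda>k. if k = l then 1 else 0"]) simp
    then have "b' l \<in> span (lattice_gen {1..r} b)"
      using rec by (auto simp: reciprocal_basis_def lattice_basis_def reciprocal_lattice_def)
    then show ?thesis using span_mono[OF gen_span] by (auto simp: span_span)
  qed
  have expand: "w = (\<Sum>l\<in>{1..r}. (b (r + 1 - l) \<bullet> w) *\<^sub>R b' l)" if w: "w \<in> span (b ` {1..r})" for w
  proof -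
    define y where "y = w - (\<Sum>l\<in>{1..r}. (b (r + 1 - l) \<bullet> w) *\<^sub>R b' l)"
    have y: "y \<in> span (b ` {1..r})"
      unfolding y_def using w b'_span by (intro span_diff span_sum span_scale)
    have "b k \<bullet> y = 0" if k: "k \<in> {1..r}" for k
    proof -
      have "(\<Sum>l\<in>{1..r}. (b (r + 1 - l) \<bullet> w) * (b k \<bullet> b' l)) = (\<Sum>l\<in>{r + 1 - k}. (b (r + 1 - l) \<bullet> w) * (b k \<bullet> b' l))"
        using k by (intro sum.mono_neutral_right) (auto simp: dual)
      also have "\<dots> = b k \<bullet> w"
      proof -
        have "r + 1 - k \<in> {1..r}" "r + 1 - (r + 1 - k) = k" using k by auto
        then show ?thesis using dual[OF k] k by simp
      qed
      finally show ?thesis by (simp add: y_def inner_diff_right inner_sum_right)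
    qed
    then have "orthogonal y y"
      by (intro orthogonal_to_span[OF y]) (auto simp: orthogonal_def inner_commute)
    then show ?thesis by (simp add: orthogonal_self y_def)
  qed
  have nz: "gso b i \<noteq> 0" using gso_nonzero[OF b i] .
  have "v \<in> span (b ` {1..i})" unfolding v_def using i by (intro span_scale gso_in_span) auto
  then have v_span: "v \<in> span (b ` {1..r})"
    using span_mono[of "b ` {1..i}" "b ` {1..r}"] i by fastforce
  have "gso b' (r + 1 - i) = v"
  proof (rule gso_unique)
    fix w assume w: "w \<in> span (b' ` {1..<r + 1 - i})"
    have "b' l \<bullet> v = 0" if l: "l \<in> {1..<r + 1 - i}" for l
    proof -
      have "orthogonal (b' l) v"
        using \<open>v \<in> span (b ` {1..i})\<close>
      proof (rule orthogonal_to_span)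
        fix x assume "x \<in> b ` {1..i}"
        then obtain k where "x = b k" "k \<in> {1..i}" by blast
        with l i show "orthogonal (b' l) x"
          using dual[of k l] by (auto simp: orthogonal_def inner_commute)
      qed
      then show ?thesis by (simp add: orthogonal_def)
    qed
    then have "orthogonal v w"
      by (intro orthogonal_to_span[OF w]) (auto simp: orthogonal_def inner_commute)
    then show "w \<bullet> v = 0" by (simp add: orthogonal_def inner_commute)
  next
    let ?d = "b' (r + 1 - i) - v"
    have "?d \<in> span (b ` {1..r})" using i by (intro span_diff b'_span v_span) auto
    then have "?d = (\<Sum>l\<in>{1..r}. (b (r + 1 - l) \<bullet> ?d) *\<^sub>R b' l)" by (rule expand)
    also have "\<dots> = (\<Sum>l\<in>{1..<r + 1 - i}. (b (r + 1 - l) \<bullet> ?d) *\<^sub>R b' l)"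
    proof (rule sum.mono_neutral_right)
      show "\<forall>l\<in>{1..r} - {1..<r + 1 - i}. (b (r + 1 - l) \<bullet> ?d) *\<^sub>R b' l = 0"
      proof
        fix l assume l: "l \<in> {1..r} - {1..<r + 1 - i}"
        define k where "k = r + 1 - l"
        have k: "1 \<le> k" "k \<le> i" "k \<in> {1..r}" using l i by (auto simp: k_def)
        have "b k \<bullet> v = (if k = i then 1 else 0)"
          using k nz inner_gso_lower[of k i b] inner_gso_self[of b i]
          by (auto simp: v_def power2_norm_eq_inner)
        moreover have "b k \<bullet> b' (r + 1 - i) = (if k = i then 1 else 0)"
          using k i by (subst dual) auto
        ultimately show "(b (r + 1 - l) \<bullet> ?d) *\<^sub>R b' l = 0"
          unfolding k_def[symmetric] by (simp add: inner_diff_right)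
      qed
    qed (use i in auto)
    also have "\<dots> \<in> span (b' ` {1..<r + 1 - i})" by (intro span_sum span_scale span_base) auto
    finally show "?d \<in> span (b' ` {1..<r + 1 - i})" .
  qed
  then show ?thesis by (simp add: v_def)
qed

text \<open>Both the lattice of \<open>b 1, \<dots>, b i\<close> and its reciprocal obey Minkowski's bound; in the product the
  determinants cancel, and the first minimum of the reciprocal lattice is \<open>1 / norm (gso b i)\<close> by reducedness.\<close>

lemma RKZ_gso_lower_bound:
  fixes b :: "nat \<Rightarrow> 'a::euclidean_space"
  assumes RKZ: "RKZ_reduced_basis r b L" and i: "i \<in> {1..r}"
    and "t > 0" and min: "\<And>w. w \<in> L \<Longrightarrow> w \<noteq> 0 \<Longrightarrow> t \<le> norm w"
  shows "(unit_ball_vol (real i))\<^sup>2 * t ^ i \<le> 4 ^ i * norm (gso b i) ^ i"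
proof -
  have b: "inj_on b {1..r}" "independent (b ` {1..r})" and L: "L = lattice_gen {1..r} b"
    using RKZ by (auto simp: RKZ_reduced_basis_def lattice_basis_def)
  obtain b' where rec: "reciprocal_basis r b b'" and KZ: "KZ_reduced_basis r b' (reciprocal_lattice L)"
    using RKZ by (auto simp: RKZ_reduced_basis_def)
  have b': "inj_on b' {1..r}" "independent (b' ` {1..r})"
    using KZ by (auto simp: KZ_reduced_basis_def lattice_basis_def)
  \<comment> \<open>Reversal matches the block \<open>{j..r}\<close> of \<open>b'\<close> with
    \<open>{1..i}\<close>. The lattice of the tails from index \<open>j\<close> is the reciprocal of
    the lattice of \<open>b 1, ..., b i\<close>, and both have rank \<open>i\<close>.\<close>
  define j where "j = r + 1 - i"
  have j: "j \<in> {1..r}" "card {j..r} = i" using i by (auto simp: j_def)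
  define V where "V = unit_ball_vol (real i)"
  have V: "V > 0" by (simp add: V_def)
  have norm_rec: "norm (gso b' (r + 1 - k)) = 1 / norm (gso b k)" if "k \<in> {1..r}" for k
    unfolding reciprocal_basis_gso[OF b rec that] using gso_nonzero[OF b that]
    by (simp add: power2_eq_square divide_inverse)
  have "unit_ball_vol (card {1..i}) * t ^ card {1..i} \<le> 2 ^ card {1..i} * (\<Prod>k\<in>{1..i}. norm (gso b k))"
  proof (rule minkowski_lattice_gen[where c = b])
    fix k assume k: "k \<in> {1..i}"
    show "gso b k \<noteq> 0" using gso_nonzero[OF b] k i by auto
    have "{l \<in> {1..i}. l < k} = {1..<k}" using k by auto
    then show "b k - gso b k \<in> span (gso b ` {l \<in> {1..i}. l < k})"
      using gso_diff_in_span[of b k] by (simp only: span_gso)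
  next
    fix w assume w: "w \<in> lattice_gen {1..i} b" "w \<noteq> 0"
    then obtain z where z: "w = (\<Sum>k\<in>{1..i}. real_of_int (z k) *\<^sub>R b k)"
      by (auto simp: lattice_gen_def)
    have "w = (\<Sum>k\<in>{1..r}. real_of_int (if k \<le> i then z k else 0) *\<^sub>R b k)"
      unfolding z using i by (intro sum.mono_neutral_cong_left) auto
    then have "w \<in> L"
      unfolding L lattice_gen_def mem_Collect_eq by (intro exI[of _ "\<lambda>k. if k \<le> i then z k else 0"]) simp
    then show "t \<le> norm w" using w(2) by (rule min)
  qed (use \<open>t > 0\<close> in \<open>auto simp: inner_gso_gso\<close>)
  then have K: "V * t ^ i \<le> 2 ^ i * (\<Prod>k\<in>{1..i}. norm (gso b k))" by (simp add: V_def)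
  define \<nu> where "\<nu> = norm (gso b' j)"
  \<comment> \<open>The sum in \<open>gso_tail b' j j\<close> is empty, so the shortest vector is
    \<open>gso b' j\<close> itself; its norm \<open>\<nu>\<close> can therefore play the role of
    \<open>t\<close> in Minkowski's bound.\<close>
  have short: "shortest_nonzero (lattice_gen {j..r} (\<lambda>k. gso_tail b' k j)) (gso b' j)"
    using KZ j by (auto simp: KZ_reduced_basis_def gso_tail_def)
  have "unit_ball_vol (card {j..r}) * \<nu> ^ card {j..r} \<le> 2 ^ card {j..r} * (\<Prod>k\<in>{j..r}. norm (gso b' k))"
  proof (rule minkowski_lattice_gen[where c = "\<lambda>k. gso_tail b' k j"])
    fix k assume k: "k \<in> {j..r}"
    show "gso b' k \<noteq> 0" using gso_nonzero[OF b'] k j by auto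
    have "{l \<in> {j..r}. l < k} = {j..<k}" using k by auto
    moreover have "(\<Sum>l\<in>{j..<k}. gso_mu b' k l *\<^sub>R gso b' l) \<in> span (gso b' ` {j..<k})"
      by (intro span_sum span_scale span_base) auto
    ultimately show "gso_tail b' k j - gso b' k \<in> span (gso b' ` {l \<in> {j..r}. l < k})"
      by (simp add: gso_tail_def)
  qed (use short j in \<open>auto simp: inner_gso_gso \<nu>_def shortest_nonzero_def\<close>)
  then have K': "V * \<nu> ^ i \<le> 2 ^ i * (\<Prod>k\<in>{j..r}. norm (gso b' k))" by (simp only: j V_def)
  have "(\<Prod>k\<in>{j..r}. norm (gso b' k)) = (\<Prod>k\<in>{1..i}. norm (gso b' (r + 1 - k)))"
    by (rule prod.reindex_bij_witness[of _ "\<lambda>k. r + 1 - k" "\<lambda>k. r + 1 - k"]) (use i in \<open>auto simp: j_def\<close>)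
  also have "\<dots> = (\<Prod>k\<in>{1..i}. 1 / norm (gso b k))"
    using i by (intro prod.cong norm_rec) auto
  also have "\<dots> = 1 / (\<Prod>k\<in>{1..i}. norm (gso b k))" by (simp add: prod_dividef)
  finally have prod_rec: "(\<Prod>k\<in>{j..r}. norm (gso b' k)) = 1 / (\<Prod>k\<in>{1..i}. norm (gso b k))" .
  have pos: "(\<Prod>k\<in>{1..i}. norm (gso b k)) > 0"
    using gso_nonzero[OF b] i by (intro prod_pos) auto
  have "(V * t ^ i) * (V * \<nu> ^ i) \<le>
      (2 ^ i * (\<Prod>k\<in>{1..i}. norm (gso b k))) * (2 ^ i * (\<Prod>k\<in>{j..r}. norm (gso b' k)))"
    using V pos by (intro mult_mono[OF K K']) (auto simp: \<nu>_def)
  also have "\<dots> = 4 ^ i"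
    unfolding prod_rec using less_imp_neq[OF pos] by (simp del: prod_zero_iff flip: power_mult_distrib)
  finally have main: "V\<^sup>2 * t ^ i * \<nu> ^ i \<le> 4 ^ i" by (simp add: power2_eq_square mult_ac)
  have "\<nu> = 1 / norm (gso b i)" unfolding \<nu>_def j_def by (rule norm_rec[OF i])
  moreover have "norm (gso b i) > 0" using gso_nonzero[OF b i] by simp
  ultimately show ?thesis using main by (simp add: V_def power_divide field_simps)
qed

text \<open>An \<open>i\<close>-th root of the volume estimates. The natural factor
  \<open>1 + i / 4\<close> is weakened to \<open>1 + r / 4\<close>, so that one radius for kernel
  vectors serves all Gram-Schmidt vectors.\<close>

lemma RKZ_gso_norm_greater:
  fixes b :: "nat \<Rightarrow> 'a::euclidean_space"
  assumes RKZ: "RKZ_reduced_basis r b L" and i: "i \<in> {1..r}" and "r \<le> 30" and "s > 0"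
    and min: "\<And>w. w \<in> L \<Longrightarrow> w \<noteq> 0 \<Longrightarrow> s * (1 + real r / 4) \<le> norm w"
  shows "s < norm (gso b i)"
proof -
  have pos: "1 + real r / 4 > 0" by (simp add: add_pos_nonneg)
  \<comment> \<open>One factor \<open>4 ^ i\<close> comes from the two uses of Minkowski's bound,
    the other is the denominator of \<open>(1 + i / 4) ^ i\<close>.\<close>
  have "(16 :: real) ^ i = 4 ^ i * 4 ^ i" by (simp flip: power_mult_distrib)
  then have "4 ^ i * s ^ i = s ^ i * 16 ^ i / 4 ^ i" by simp
  also have "\<dots> < s ^ i * ((unit_ball_vol (real i))\<^sup>2 * (4 + real i) ^ i) / 4 ^ i"
    using unit_ball_vol_lower_bound[of i] i assms(3,4)
    by (intro divide_strict_right_mono mult_strict_left_mono) auto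
  also have "\<dots> = (unit_ball_vol (real i))\<^sup>2 * (s * (1 + real i / 4)) ^ i"
  proof -
    have "(1 + real i / 4) ^ i = (4 + real i) ^ i / 4 ^ i"
      by (simp add: power_divide[symmetric] add_divide_distrib)
    then show ?thesis by (simp add: power_mult_distrib)
  qed
  also have "\<dots> \<le> (unit_ball_vol (real i))\<^sup>2 * (s * (1 + real r / 4)) ^ i"
    using i \<open>s > 0\<close> by (intro mult_left_mono power_mono) auto
  also have "\<dots> \<le> 4 ^ i * norm (gso b i) ^ i"
    using RKZ i by (rule RKZ_gso_lower_bound) (use pos \<open>s > 0\<close> min in auto)
  finally have "s ^ i < norm (gso b i) ^ i" by simp
  then show ?thesis using \<open>s > 0\<close> by (meson power_less_imp_less_base norm_ge_zero)
qed

section \<open>Matrices with a short integer kernel vector\<close>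

text \<open>The solutions \<open>y\<close> lie in a single residue class modulo
  \<open>e = d div gcd d x\<close>, and such a class has at most \<open>(M - 1) div e + 1\<close>
  members among \<open>M\<close> consecutive integers.\<close>

lemma card_arith_progression:
  fixes x s d :: int
  assumes "d > 0" "M > 0"
  shows "real (card {y \<in> {1..int M}. d dvd y * x + s}) * real_of_int (d div gcd d x)
    \<le> real M + real_of_int (d div gcd d x) - 1"
proof -
  define e where "e = d div gcd d x"
  define Y where "Y = {y \<in> {1..int M}. d dvd y * x + s}"
  have e: "e > 0" using assms unfolding e_def by (simp add: pos_imp_zdiv_pos_iff zdvd_imp_le)
  have cong: "e dvd y - y'" if "y \<in> Y" "y' \<in> Y" for y y'
  proof -
    have "d dvd (y * x + s) - (y' * x + s)" using that unfolding Y_def by (intro dvd_diff) auto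
    then have "d dvd (y - y') * x" by (simp add: algebra_simps)
    then have "d dvd gcd ((y - y') * d) ((y - y') * x)" by simp
    also have "gcd ((y - y') * d) ((y - y') * x) = \<bar>y - y'\<bar> * gcd d x"
      by (simp add: gcd_mult_left abs_mult)
    finally have "e * gcd d x dvd \<bar>y - y'\<bar> * gcd d x" by (simp add: e_def)
    then show ?thesis using assms by simp
  qed
  \<comment> \<open>Members of one residue class are told apart by the block of length
    \<open>e\<close> that contains them; the shift by 1 makes the first block start at the left end
    of the interval.\<close>
  have inj: "inj_on (\<lambda>y. (y - 1) div e) Y"
  proof (rule inj_onI)
    fix y y' assume *: "y \<in> Y" "y' \<in> Y" "(y - 1) div e = (y' - 1) div e"
    from cong[OF *(1,2)] have "(y - 1) mod e = (y' - 1) mod e"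
      by (metis diff_diff_eq2 mod_eq_dvd_iff add_diff_cancel diff_add_cancel)
    with *(3) have "y - 1 = y' - 1" by (metis div_mult_mod_eq)
    then show "y = y'" by simp
  qed
  have "(\<lambda>y. (y - 1) div e) ` Y \<subseteq> {0..(int M - 1) div e}"
    using e by (auto simp: Y_def pos_imp_zdiv_nonneg_iff zdiv_mono1)
  then have "card Y \<le> card {0..(int M - 1) div e}"
    using card_mono[of "{0..(int M - 1) div e}"] card_image[OF inj] by (metis finite_atLeastAtMost_int)
  then have "int (card Y) \<le> (int M - 1) div e + 1"
  proof -
    have "0 \<le> (int M - 1) div e" using e assms by (simp add: pos_imp_zdiv_nonneg_iff)
    then show ?thesis using \<open>card Y \<le> _\<close> by simp
  qed
  then have "int (card Y) * e \<le> ((int M - 1) div e + 1) * e" using e by simp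
  also have "\<dots> \<le> int M - 1 + e"
    using div_mult_mod_eq[of "int M - 1" e] pos_mod_sign[OF e, of "int M - 1"]
    unfolding distrib_right by linarith
  finally have "real_of_int (int (card Y) * e) \<le> real_of_int (int M - 1 + e)" by linarith
  then show ?thesis unfolding e_def[symmetric] Y_def[symmetric] by simp
qed

text \<open>Summing out one coordinate replaces the modulus by its gcd with the coefficient. The loss factors
  \<open>1 + (e - 1) / M\<close> of the steps, \<open>e\<close> being the quotient of successive moduli, multiply to at most one
  such factor for the product of the \<open>e\<close>.\<close>

lemma card_dvd_linear_form:
  fixes x :: "'i \<Rightarrow> int" and d s :: int
  assumes "finite J" "d > 0" "M > 0"
  shows "real (card {f \<in> (\<Pi>\<^sub>E i\<in>J. {1..int M}). d dvd (\<Sum>i\<in>J. f i * x i) + s})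
      * real_of_int (d div Gcd (insert d (x ` J))) * real M
    \<le> real M ^ card J * (real M + real_of_int (d div Gcd (insert d (x ` J))) - 1)"
  using assms
proof (induction J arbitrary: d s rule: finite_induct)
  case empty
  have "card {f \<in> (\<Pi>\<^sub>E i\<in>{}. {1..int M}). d dvd (\<Sum>i\<in>{}. f i * x i) + s} \<le> 1"
    by (rule order.trans[OF card_mono[of "{\<lambda>_. undefined}"]]) auto
  with empty show ?case by (simp add: mult_le_cancel_right1)
next
  case (insert j J)
  define g where "g = gcd d (x j)"
  define h where "h = Gcd (insert d (x ` insert j J))"
  have g: "g > 0" "g dvd d" using insert.prems by (auto simp: g_def)
  have h_eq: "h = Gcd (insert g (x ` J))"
    unfolding h_def g_def by (simp add: gcd.assoc)
  have h: "h > 0" "h dvd g"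
    using g unfolding h_eq by (auto intro: Gcd_dvd simp: order_le_less)
  \<comment> \<open>Modulo \<open>g\<close>, which divides both \<open>d\<close> and
    \<open>x j\<close>, coordinate \<open>j\<close> disappears, so the other coordinates form an
    element of \<open>B\<close>; over each such element \<open>c\<close> collects the possible
    values at \<open>j\<close>.\<close>
  define B where "B = {f \<in> (\<Pi>\<^sub>E i\<in>J. {1..int M}). g dvd (\<Sum>i\<in>J. f i * x i) + s}"
  define c where "c f = {y \<in> {1..int M}. d dvd y * x j + ((\<Sum>i\<in>J. f i * x i) + s)}" for f
  define A where "A = {f \<in> (\<Pi>\<^sub>E i\<in>insert j J. {1..int M}). d dvd (\<Sum>i\<in>insert j J. f i * x i) + s}"
  define \<alpha> where "\<alpha> = real_of_int (d div g)"
  define \<beta> where "\<beta> = real_of_int (g div h)"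
  have sumj: "(\<Sum>i\<in>J. (f(j := y)) i * x i) = (\<Sum>i\<in>J. f i * x i)" for f y
    using insert.hyps by (intro sum.cong) auto
  have finB: "finite B"
  proof (rule finite_subset)
    show "B \<subseteq> (\<Pi>\<^sub>E i\<in>J. {1..int M})" by (auto simp: B_def)
  qed (use insert.hyps in \<open>auto intro: finite_PiE\<close>)
  have finc: "finite (c f)" for f
    unfolding c_def by (rule finite_subset[of _ "{1..int M}"]) auto
  have "A \<subseteq> (\<lambda>(f, y). f(j := y)) ` (SIGMA f:B. c f)"
  proof
    fix f assume f: "f \<in> A"
    define f' where "f' = f(j := undefined)"
    have f': "f' \<in> (\<Pi>\<^sub>E i\<in>J. {1..int M})" "f = f'(j := f j)"
      using f insert.hyps unfolding A_def f'_def by (auto simp: PiE_def Pi_def extensional_def)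
    have s: "(\<Sum>i\<in>J. f' i * x i) = (\<Sum>i\<in>J. f i * x i)" unfolding f'_def by (rule sumj)
    have d: "d dvd f j * x j + ((\<Sum>i\<in>J. f' i * x i) + s)"
      using f insert.hyps unfolding A_def s by (simp add: add.assoc)
    then have "g dvd f j * x j + ((\<Sum>i\<in>J. f' i * x i) + s)" using g(2) by (rule dvd_trans[rotated])
    moreover have "g dvd f j * x j" by (simp add: g_def)
    ultimately have "g dvd (\<Sum>i\<in>J. f' i * x i) + s" by (simp add: dvd_add_right_iff)
    moreover have "f j \<in> {1..int M}" using f unfolding A_def by (auto simp: PiE_def Pi_def)
    ultimately have "(f', f j) \<in> (SIGMA f:B. c f)" using f'(1) d by (auto simp: B_def c_def)
    moreover have "f = (\<lambda>(f, y). f(j := y)) (f', f j)" unfolding case_prod_conv by (rule f'(2))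
    ultimately show "f \<in> (\<lambda>(f, y). f(j := y)) ` (SIGMA f:B. c f)" by (rule rev_image_eqI)
  qed
  then have "card A \<le> card ((\<lambda>(f, y). f(j := y)) ` (SIGMA f:B. c f))"
    using finB finc by (intro card_mono finite_imageI finite_SigmaI)
  also have "\<dots> \<le> card (SIGMA f:B. c f)"
    using finB finc by (intro card_image_le finite_SigmaI)
  also have "\<dots> = (\<Sum>f\<in>B. card (c f))" using finB finc by (intro card_SigmaI) auto
  finally have "real (card A) \<le> (\<Sum>f\<in>B. real (card (c f)))" by (metis of_nat_le_iff of_nat_sum)
  then have "real (card A) * \<alpha> \<le> (\<Sum>f\<in>B. real (card (c f)) * \<alpha>)"
    using g by (simp add: \<alpha>_def sum_distrib_right[symmetric] mult_right_mono pos_imp_zdiv_nonneg_iff insert.prems less_imp_le)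
  also have "\<dots> \<le> (\<Sum>f\<in>B. real M + \<alpha> - 1)"
    unfolding \<alpha>_def g_def c_def using insert.prems by (intro sum_mono card_arith_progression)
  finally have A: "real (card A) * \<alpha> \<le> real (card B) * (real M + \<alpha> - 1)" by simp
  have B: "real (card B) * \<beta> * real M \<le> real M ^ card J * (real M + \<beta> - 1)"
    using insert.IH[OF g(1) insert.prems(2), of s] by (simp add: B_def \<beta>_def h_eq)
  have \<alpha>: "\<alpha> \<ge> 1" using g insert.prems by (auto simp: \<alpha>_def dvd_def zero_less_mult_iff)
  have \<beta>: "\<beta> \<ge> 1" using g h by (auto simp: \<beta>_def dvd_def zero_less_mult_iff)
  have M: "real M \<ge> 1" using insert.prems by simp
  have \<alpha>\<beta>: "real_of_int (d div h) = \<alpha> * \<beta>"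
    using g h by (auto simp: \<alpha>_def \<beta>_def dvd_def)
  have "real (card A) * (\<alpha> * \<beta>) * real M = (real (card A) * \<alpha>) * (\<beta> * real M)" by simp
  also have "\<dots> \<le> (real (card B) * (real M + \<alpha> - 1)) * (\<beta> * real M)"
    using A \<beta> by (intro mult_right_mono) auto
  also have "\<dots> = (real (card B) * \<beta> * real M) * (real M + \<alpha> - 1)" by simp
  also have "\<dots> \<le> (real M ^ card J * (real M + \<beta> - 1)) * (real M + \<alpha> - 1)"
    using B \<alpha> M by (intro mult_right_mono) auto
  also have "\<dots> = real M ^ card J * ((real M + \<beta> - 1) * (real M + \<alpha> - 1))" by simp
  also have "\<dots> \<le> real M ^ card J * (real M * (real M + \<alpha> * \<beta> - 1))"
  proof (intro mult_left_mono)
    \<comment> \<open>This product is exactly the right-hand side minus the left-hand side of the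
      inequality below; here two loss factors merge into one.\<close>
    have "0 \<le> (real M - 1) * ((\<alpha> - 1) * (\<beta> - 1))" using \<alpha> \<beta> M by simp
    then show "(real M + \<beta> - 1) * (real M + \<alpha> - 1) \<le> real M * (real M + \<alpha> * \<beta> - 1)"
      by (simp add: algebra_simps)
  qed simp
  finally show ?case
    unfolding A_def[symmetric] h_def[symmetric] \<alpha>\<beta> using insert.hyps by (simp add: mult_ac)
qed

section \<open>Counting vectors and matrices row by row\<close>

lemma vec_eq_image_fun: "{v :: 'a^'i. \<forall>i. v $ i \<in> R} = vec_lambda ` (UNIV \<rightarrow>\<^sub>E R)"
proof (intro equalityI subsetI)
  fix v :: "'a^'i" assume "v \<in> {v. \<forall>i. v $ i \<in> R}"
  then have "($) v \<in> UNIV \<rightarrow>\<^sub>E R" by auto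
  then show "v \<in> vec_lambda ` (UNIV \<rightarrow>\<^sub>E R)" by (metis vec_nth_inverse image_eqI)
qed auto

lemma finite_vec_components:
  assumes "finite R"
  shows "finite {v :: 'a^'i. \<forall>i. v $ i \<in> R}"
  unfolding vec_eq_image_fun using assms by (intro finite_imageI finite_PiE) auto

text \<open>\<open>R\<close> may itself consist of vectors: a matrix is a vector of rows, so the
  same count applies to entries of a row and to rows of a matrix.\<close>

lemma card_vec_components: "card {v :: 'a^'i. \<forall>i. v $ i \<in> R} = card R ^ CARD('i)"
proof -
  have "card {v :: 'a^'i. \<forall>i. v $ i \<in> R} = card (UNIV \<rightarrow>\<^sub>E R :: ('i \<Rightarrow> 'a) set)"
    unfolding vec_eq_image_fun by (intro card_image inj_onI) (metis vec_lambda_inverse UNIV_I)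
  then show ?thesis by (simp add: card_PiE)
qed

lemma card_mat_G: "card (mat_G M :: (int^'n^'m) set) = (M ^ CARD('n)) ^ CARD('m)"
proof -
  have "mat_G M = {A :: int^'n^'m. \<forall>i. A $ i \<in> {a. \<forall>j. a $ j \<in> {1..int M}}}"
    by (auto simp: mat_G_def)
  then show ?thesis by (simp only: card_vec_components) simp
qed

lemma finite_mat_G: "finite (mat_G M :: (int^'n^'m) set)"
proof -
  have "mat_G M = {A :: int^'n^'m. \<forall>i. A $ i \<in> {a. \<forall>j. a $ j \<in> {1..int M}}}"
    by (auto simp: mat_G_def)
  then show ?thesis by (simp only:) (intro finite_vec_components finite_atLeastAtMost_int)
qed

text \<open>The other entries determine \<open>a $ j\<close>, and they admit a solution only if
  \<open>\<bar>x $ j\<bar>\<close> divides their sum. For primitive \<open>x\<close> this modulus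
  and the other entries have gcd 1, so the divisibility gains the full factor
  \<open>\<bar>x $ j\<bar>\<close>. The bound decreases in that modulus, which permits the uniform
  \<open>c\<close>.\<close>

lemma card_orthogonal_row:
  fixes x :: "int^'n"
  assumes prim: "Gcd (range (($) x)) = 1" and c: "0 < c" "c \<le> \<bar>x $ j\<bar>" and M: "M > 0"
  shows "real (card {a :: int^'n. (\<forall>i. a $ i \<in> {1..int M}) \<and> (\<Sum>i\<in>UNIV. a $ i * x $ i) = 0}) * real M
    \<le> real M ^ (CARD('n) - 1) * ((real M - 1) / real_of_int c + 1)"
proof -
  define J where "J = UNIV - {j}"
  define d where "d = \<bar>x $ j\<bar>"
  have d: "d > 0" using c by (simp add: d_def)
  define A where "A = {a :: int^'n. (\<forall>i. a $ i \<in> {1..int M}) \<and> (\<Sum>i\<in>UNIV. a $ i * x $ i) = 0}"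
  define B where "B = {f \<in> (\<Pi>\<^sub>E i\<in>J. {1..int M}). d dvd (\<Sum>i\<in>J. f i * x $ i) + 0}"
  define \<phi> where "\<phi> a = restrict (($) a) J" for a :: "int^'n"
  have split: "(\<Sum>i\<in>UNIV. a $ i * x $ i) = a $ j * x $ j + (\<Sum>i\<in>J. a $ i * x $ i)" for a
    unfolding J_def by (subst sum.remove[of _ j]) auto
  have "inj_on \<phi> A"
  proof (rule inj_onI)
    fix a a' assume a: "a \<in> A" "a' \<in> A" "\<phi> a = \<phi> a'"
    then have eq: "a $ i = a' $ i" if "i \<in> J" for i
      using that by (auto simp: \<phi>_def fun_eq_iff restrict_def split: if_splits dest: spec[of _ i])
    then have "(\<Sum>i\<in>J. a $ i * x $ i) = (\<Sum>i\<in>J. a' $ i * x $ i)" by (intro sum.cong) auto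
    then have "a $ j * x $ j = a' $ j * x $ j"
      using a(1,2) unfolding A_def mem_Collect_eq split by linarith
    then have "a $ j = a' $ j" using d by (simp add: d_def)
    with eq show "a = a'" unfolding vec_eq_iff J_def by (metis Diff_iff UNIV_I singletonD)
  qed
  moreover have "\<phi> ` A \<subseteq> B"
  proof
    fix f assume "f \<in> \<phi> ` A"
    then obtain a where a: "a \<in> A" "f = \<phi> a" by blast
    have "(\<Sum>i\<in>J. f i * x $ i) = (\<Sum>i\<in>J. a $ i * x $ i)"
      unfolding a \<phi>_def by (intro sum.cong) auto
    also have "\<dots> = - (a $ j * x $ j)" using a(1) split[of a] by (simp add: A_def)
    finally have "d dvd (\<Sum>i\<in>J. f i * x $ i) + 0" by (simp add: d_def)
    moreover have "f \<in> (\<Pi>\<^sub>E i\<in>J. {1..int M})" using a by (auto simp: \<phi>_def A_def)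
    ultimately show "f \<in> B" by (simp add: B_def)
  qed
  moreover have "finite B"
  proof (rule finite_subset)
    show "B \<subseteq> (\<Pi>\<^sub>E i\<in>J. {1..int M})" by (auto simp: B_def)
  qed (auto intro: finite_PiE)
  ultimately have "card A \<le> card B" by (metis card_inj_on_le)
  have "Gcd (insert d (($) x ` J)) = Gcd (insert (x $ j) (($) x ` J))"
    by (simp add: d_def)
  also have "insert (x $ j) (($) x ` J) = range (($) x)" by (auto simp: J_def)
  finally have G: "Gcd (insert d (($) x ` J)) = 1" using prim by simp
  have "real (card A) * real_of_int d * real M \<le> real (card B) * real_of_int d * real M"
    using \<open>card A \<le> card B\<close> d by (intro mult_right_mono) auto
  also have "\<dots> \<le> real M ^ card J * (real M + real_of_int d - 1)"
    using card_dvd_linear_form[of J d M "($) x" 0] d M unfolding B_def[symmetric] G by simp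
  also have "\<dots> = (real M ^ card J * ((real M - 1) / real_of_int d + 1)) * real_of_int d"
    using d by (simp add: field_simps)
  finally have "real (card A) * real M * real_of_int d
      \<le> (real M ^ card J * ((real M - 1) / real_of_int d + 1)) * real_of_int d"
    by (simp add: mult_ac)
  then have "real (card A) * real M \<le> real M ^ card J * ((real M - 1) / real_of_int d + 1)"
    using d by simp
  also have "\<dots> \<le> real M ^ card J * ((real M - 1) / real_of_int c + 1)"
    using c M by (intro mult_left_mono add_right_mono divide_left_mono) (auto simp: d_def)
  also have "card J = CARD('n) - 1" by (simp add: J_def)
  finally show ?thesis unfolding A_def .
qed

lemma card_kernel_matrices:
  fixes x :: "int^'n"
  shows "card {A \<in> mat_G M :: (int^'n^'m) set. A *v x = 0}
    = card {a :: int^'n. (\<forall>i. a $ i \<in> {1..int M}) \<and> (\<Sum>i\<in>UNIV. a $ i * x $ i) = 0} ^ CARD('m)"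
proof -
  have "{A \<in> mat_G M :: (int^'n^'m) set. A *v x = 0} = {A. \<forall>k. A $ k \<in>
      {a :: int^'n. (\<forall>i. a $ i \<in> {1..int M}) \<and> (\<Sum>i\<in>UNIV. a $ i * x $ i) = 0}}"
    by (auto simp: mat_G_def matrix_vector_mult_def vec_eq_iff)
  then show ?thesis by (simp only: card_vec_components)
qed

lemma card_kernel_matrices_le:
  fixes x :: "int^'n"
  assumes "Gcd (range (($) x)) = 1" "0 < c" "c \<le> \<bar>x $ j\<bar>" "M > 0"
  shows "real (card {A \<in> mat_G M :: (int^'n^'m) set. A *v x = 0})
    \<le> (real M ^ CARD('n) * (((real M - 1) / real_of_int c + 1) / (real M)\<^sup>2)) ^ CARD('m)"
proof -
  have "real M * real M ^ (CARD('n) - 1) = real M ^ CARD('n)"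
    by (metis power_minus_mult[of "CARD('n)" "real M"] mult.commute zero_less_card_finite)
  then have eq: "real M ^ (CARD('n) - 1) = real M ^ CARD('n) / real M"
    using assms(4) by (simp add: field_simps)
  have "real (card {a :: int^'n. (\<forall>i. a $ i \<in> {1..int M}) \<and> (\<Sum>i\<in>UNIV. a $ i * x $ i) = 0})
      \<le> real M ^ CARD('n) * (((real M - 1) / real_of_int c + 1) / (real M)\<^sup>2)"
    using card_orthogonal_row[OF assms] assms(4) unfolding eq
    by (simp add: field_simps power2_eq_square)
  then show ?thesis unfolding card_kernel_matrices of_nat_power by (intro power_mono) auto
qed

text \<open>Unit cubes centred at the integer points lie in the ball enlarged by half a cube
  diagonal. Open cubes are used because closed ones share faces.\<close>

lemma
  fixes \<rho> :: real
  assumes "\<rho> \<ge> 0"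
  shows finite_int_points_ball: "finite {x :: int^'n. norm (real_vec x) \<le> \<rho>}"
    and card_int_points_ball: "real (card {x :: int^'n. norm (real_vec x) \<le> \<rho>})
      \<le> unit_ball_vol (real CARD('n)) * (\<rho> + sqrt (real CARD('n)) / 2) ^ CARD('n)"
proof -
  let ?X = "{x :: int^'n. norm (real_vec x) \<le> \<rho>}"
  have "?X \<subseteq> {x. \<forall>i. x $ i \<in> {-\<lceil>\<rho>\<rceil>..\<lceil>\<rho>\<rceil>}}"
  proof clarify
    fix x :: "int^'n" and i assume "norm (real_vec x) \<le> \<rho>"
    then have "\<bar>real_of_int (x $ i)\<bar> \<le> \<rho>"
      using component_le_norm_cart[of "real_vec x" i] by (simp add: real_vec_def)
    then show "x $ i \<in> {-\<lceil>\<rho>\<rceil>..\<lceil>\<rho>\<rceil>}" by (simp add: abs_le_iff) linarith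
  qed
  then show fin: "finite ?X" by (rule finite_subset) (intro finite_vec_components, simp)
  define h :: "real^'n" where "h = (\<chi> i. 1 / 2)"
  define Q where "Q x = box (real_vec x - h) (real_vec x + h)" for x :: "int^'n"
  have memQ: "v \<in> Q x \<longleftrightarrow> (\<forall>i. \<bar>v $ i - real_of_int (x $ i)\<bar> < 1 / 2)" for v x
  proof -
    have "(a - 1 / 2 < b \<and> b < a + 1 / 2) \<longleftrightarrow> \<bar>b - a\<bar> < 1 / 2" for a b :: real by arith
    then show ?thesis
      unfolding Q_def mem_box_cart h_def real_vec_def vector_minus_component vector_add_component vec_lambda_beta
      by presburger
  qed
  have disj: "disjoint_family_on Q ?X"
    unfolding disjoint_family_on_def
  proof (intro ballI impI, rule ccontr)
    fix x y :: "int^'n" assume "x \<noteq> y" "Q x \<inter> Q y \<noteq> {}"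
    then obtain v where "v \<in> Q x" "v \<in> Q y" by blast
    then have "\<bar>real_of_int (x $ i) - real_of_int (y $ i)\<bar> < 1" for i
      unfolding memQ by (smt (verit, ccfv_threshold) field_sum_of_halves)
    then have "x $ i = y $ i" for i by (metis of_int_diff of_int_abs of_int_less_1_iff zabs_less_one_iff eq_iff_diff_eq_0)
    with \<open>x \<noteq> y\<close> show False by (simp add: vec_eq_iff)
  qed
  have meas: "measure lborel (Q x) = 1" for x
  proof -
    have ne: "cbox (real_vec x - h) (real_vec x + h) \<noteq> {}"
      by (simp add: cbox_interval interval_ne_empty_cart h_def less_eq_vec_def)
    have "measure lborel (Q x) = measure lborel (cbox (real_vec x - h) (real_vec x + h))"
      unfolding Q_def by (simp only: measure_lborel_box_eq measure_lborel_cbox_eq)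
    also have "\<dots> = 1" unfolding content_cbox_cart[OF ne] by (simp add: h_def)
    finally show ?thesis .
  qed
  have "measure lborel (\<Union>x\<in>?X. Q x) \<le> measure lborel (cball 0 (\<rho> + sqrt (real CARD('n)) / 2) :: (real^'n) set)"
  proof (rule measure_mono_fmeasurable)
    show "(\<Union>x\<in>?X. Q x) \<subseteq> cball 0 (\<rho> + sqrt (real CARD('n)) / 2)"
    proof clarify
      fix x v assume x: "norm (real_vec x) \<le> \<rho>" and v: "v \<in> Q x"
      have "norm (v - real_vec x) \<le> sqrt (\<Sum>i\<in>(UNIV :: 'n set). (1 / 2)\<^sup>2)"
        unfolding norm_vec_def L2_set_def
        using v by (intro real_sqrt_le_mono sum_mono) (auto simp: memQ real_vec_def power2_le_iff_abs_le less_imp_le abs_le_square_iff[symmetric] intro!: less_imp_le)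
      also have "\<dots> = sqrt (real CARD('n)) / 2" by (simp add: real_sqrt_divide power2_eq_square)
      finally show "v \<in> cball 0 (\<rho> + sqrt (real CARD('n)) / 2)"
        using x norm_triangle_ineq[of "real_vec x" "v - real_vec x"] by simp
    qed
    show "cball 0 (\<rho> + sqrt (real CARD('n)) / 2) \<in> fmeasurable (lborel :: (real^'n) measure)"
      by (rule fmeasurableI[OF _ emeasure_lborel_cball_finite]) simp
  qed (use fin in \<open>auto simp: Q_def\<close>)
  moreover have "measure lborel (\<Union>x\<in>?X. Q x) = (\<Sum>x\<in>?X. measure lborel (Q x))"
  proof (rule measure_finite_Union[OF fin _ disj])
    show "emeasure lborel (Q x) \<noteq> \<infinity>" for x
      using emeasure_lborel_box_finite unfolding Q_def by (metis order_less_irrefl)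
  qed (auto simp: Q_def)
  ultimately show "real (card ?X) \<le> unit_ball_vol (real CARD('n)) * (\<rho> + sqrt (real CARD('n)) / 2) ^ CARD('n)"
    using assms by (simp add: meas content_cball)
qed

text \<open>Lets the union bound run over primitive vectors only: a common factor makes entries
  large without making orthogonality any rarer.\<close>

lemma primitive_kernel_vector:
  fixes A :: "int^'n^'m" and x :: "int^'n"
  assumes "x \<noteq> 0" "A *v x = 0"
  obtains y where "Gcd (range (($) y)) = 1" "A *v y = 0" "norm (real_vec y) \<le> norm (real_vec x)"
proof -
  define g where "g = Gcd (range (($) x))"
  have "g \<noteq> 0" using assms(1) by (auto simp: g_def vec_eq_iff)
  moreover have "g \<ge> 0" unfolding g_def Gcd_int_def by (rule of_nat_0_le_iff)
  ultimately have g: "g > 0" by simp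
  have "g dvd x $ i" for i unfolding g_def by (intro Gcd_dvd) auto
  then obtain y' where y': "\<And>i. x $ i = g * y' i" unfolding dvd_def by metis
  define y where "y = (\<chi> i. y' i)"
  have x: "x $ i = g * y $ i" for i by (simp add: y_def y')
  have "range (($) x) = (*) g ` range (($) y)" by (auto simp: x image_image)
  then have "g = normalize (g * Gcd (range (($) y)))" by (metis g_def Gcd_mult)
  also have "\<dots> = g * Gcd (range (($) y))" using g by (simp add: abs_mult)
  finally have "Gcd (range (($) y)) = 1" using g by simp
  moreover have "A *v y = 0"
  proof -
    have "g * (A *v y) $ i = (A *v x) $ i" for i
      by (simp add: matrix_vector_mult_def x sum_distrib_left mult_ac)
    then show ?thesis using assms(2) g by (simp add: vec_eq_iff)
  qed
  moreover have "norm (real_vec y) \<le> norm (real_vec x)"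
  proof -
    have "real_vec x = real_of_int g *\<^sub>R real_vec y" by (simp add: real_vec_def vec_eq_iff x)
    then have "norm (real_vec x) = real_of_int g * norm (real_vec y)" using g by simp
    moreover have "1 * norm (real_vec y) \<le> real_of_int g * norm (real_vec y)"
      using g by (intro mult_right_mono) auto
    ultimately show ?thesis by simp
  qed
  ultimately show ?thesis by (rule that)
qed

text \<open>A primitive kernel vector with entries at most \<open>4\<close> in absolute value is one of \<open>9 ^ CARD('n)\<close>, few enough
  for the trivial bound; any other kills a random row with probability at most about \<open>1 / (5 * M)\<close>.\<close>

lemma card_matrices_short_kernel_vector:
  assumes "\<rho> \<ge> 0" "M > 0"
  shows "real (card {A \<in> mat_G M :: (int^'n^'m) set. \<exists>x. x \<noteq> 0 \<and> A *v x = 0 \<and> norm (real_vec x) \<le> \<rho>})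
    \<le> real (card (mat_G M :: (int^'n^'m) set)) *
      (9 ^ CARD('n) / real M ^ CARD('m) +
       unit_ball_vol (real CARD('n)) * (\<rho> + sqrt (real CARD('n)) / 2) ^ CARD('n) *
         ((real M + 4) / (5 * (real M)\<^sup>2)) ^ CARD('m))"
proof -
  define K where "K x = {A \<in> mat_G M :: (int^'n^'m) set. A *v x = 0}" for x
  \<comment> \<open>The threshold is a compromise: a larger one would improve the probability bound
    for \<open>X2\<close> but enlarge \<open>X1\<close>, which is counted without regard to the
    radius.\<close>
  define X1 where "X1 = {x :: int^'n. Gcd (range (($) x)) = 1 \<and> (\<forall>i. x $ i \<in> {-4..4})}"
  define X2 where "X2 = {x :: int^'n. Gcd (range (($) x)) = 1 \<and> norm (real_vec x) \<le> \<rho> \<and> (\<exists>i. 5 \<le> \<bar>x $ i\<bar>)}"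
  define P where "P = real (card (mat_G M :: (int^'n^'m) set))"
  have P: "P = (real M ^ CARD('n)) ^ CARD('m)" by (simp add: P_def card_mat_G)
  have "finite X1"
    by (rule finite_subset[of _ "{x. \<forall>i. x $ i \<in> {-4..4}}"])
      (auto simp only: X1_def intro!: finite_vec_components)
  moreover have "finite X2"
    by (rule finite_subset[OF _ finite_int_points_ball[OF assms(1)]]) (auto simp only: X2_def)
  ultimately have fin: "finite X1" "finite X2" by blast+
  have finK: "finite (K x)" for x unfolding K_def by (rule finite_subset[OF _ finite_mat_G[of M]]) auto
  have K1: "real (card (K x)) \<le> P * (1 / real M ^ CARD('m))" if x: "x \<in> X1" for x
  proof -
    have prim: "Gcd (range (($) x)) = 1" using x by (simp add: X1_def)
    have "\<not> (\<forall>i. x $ i = 0)"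
    proof
      assume "\<forall>i. x $ i = 0"
      then have "Gcd (range (($) x)) = 0" by simp
      with prim show False by simp
    qed
    then obtain j where "x $ j \<noteq> 0" by blast
    then have "1 \<le> \<bar>x $ j\<bar>" by linarith
    from card_kernel_matrices_le[OF prim _ this assms(2), where 'm = 'm]
    have "real (card (K x)) \<le> (real M ^ CARD('n) * (real M / (real M)\<^sup>2)) ^ CARD('m)"
      unfolding K_def by simp
    also have "\<dots> = P * (1 / real M ^ CARD('m))"
      using assms(2) by (simp add: P power_mult_distrib power_divide power2_eq_square)
    finally show ?thesis .
  qed
  have K2: "real (card (K x)) \<le> P * ((real M + 4) / (5 * (real M)\<^sup>2)) ^ CARD('m)" if x: "x \<in> X2" for x
  proof -
    from x obtain j where prim: "Gcd (range (($) x)) = 1" and "5 \<le> \<bar>x $ j\<bar>" by (auto simp: X2_def)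
    from card_kernel_matrices_le[OF prim _ this(2) assms(2), where 'm = 'm]
    have "real (card (K x)) \<le> (real M ^ CARD('n) * (((real M - 1) / 5 + 1) / (real M)\<^sup>2)) ^ CARD('m)"
      unfolding K_def by simp
    also have "((real M - 1) / 5 + 1) / (real M)\<^sup>2 = (real M + 4) / (5 * (real M)\<^sup>2)"
      by (simp add: field_simps)
    finally show ?thesis unfolding P power_mult_distrib .
  qed
  have "{A \<in> mat_G M :: (int^'n^'m) set. \<exists>x. x \<noteq> 0 \<and> A *v x = 0 \<and> norm (real_vec x) \<le> \<rho>}
      \<subseteq> (\<Union>x\<in>X1. K x) \<union> (\<Union>x\<in>X2. K x)"
  proof clarify
    fix A :: "int^'n^'m" and x
    assume A: "A \<in> mat_G M" and x: "x \<noteq> 0" "A *v x = 0" "norm (real_vec x) \<le> \<rho>"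
      and no: "A \<notin> (\<Union>x\<in>X2. K x)"
    obtain y where y: "Gcd (range (($) y)) = 1" "A *v y = 0" "norm (real_vec y) \<le> norm (real_vec x)"
      using primitive_kernel_vector[OF x(1,2)] by blast
    have "y \<notin> X2" using no A y(2) by (auto simp: K_def)
    with y x(3) have small: "\<not> 5 \<le> \<bar>y $ i\<bar>" for i unfolding X2_def by fastforce
    have "y $ i \<in> {-4..4}" for i using small[of i] by auto
    with y A show "A \<in> (\<Union>x\<in>X1. K x)" by (auto simp: X1_def K_def)
  qed
  then have "card {A \<in> mat_G M :: (int^'n^'m) set. \<exists>x. x \<noteq> 0 \<and> A *v x = 0 \<and> norm (real_vec x) \<le> \<rho>}
      \<le> card ((\<Union>x\<in>X1. K x) \<union> (\<Union>x\<in>X2. K x))"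
    using fin finK by (intro card_mono) auto
  also have "\<dots> \<le> card (\<Union>x\<in>X1. K x) + card (\<Union>x\<in>X2. K x)" by (rule card_Un_le)
  also have "\<dots> \<le> (\<Sum>x\<in>X1. card (K x)) + (\<Sum>x\<in>X2. card (K x))"
    using fin by (intro add_mono card_UN_le)
  finally have "real (card {A \<in> mat_G M :: (int^'n^'m) set. \<exists>x. x \<noteq> 0 \<and> A *v x = 0 \<and> norm (real_vec x) \<le> \<rho>})
      \<le> real ((\<Sum>x\<in>X1. card (K x)) + (\<Sum>x\<in>X2. card (K x)))" by (rule of_nat_mono)
  also have "\<dots> = (\<Sum>x\<in>X1. real (card (K x))) + (\<Sum>x\<in>X2. real (card (K x)))" by simp
  also have "\<dots> \<le> (\<Sum>x\<in>X1. P * (1 / real M ^ CARD('m)))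
      + (\<Sum>x\<in>X2. P * ((real M + 4) / (5 * (real M)\<^sup>2)) ^ CARD('m))"
    using K1 K2 by (intro add_mono sum_mono) auto
  also have "\<dots> = real (card X1) * (P * (1 / real M ^ CARD('m)))
      + real (card X2) * (P * ((real M + 4) / (5 * (real M)\<^sup>2)) ^ CARD('m))" by simp
  also have "\<dots> \<le> 9 ^ CARD('n) * (P * (1 / real M ^ CARD('m)))
      + (unit_ball_vol (real CARD('n)) * (\<rho> + sqrt (real CARD('n)) / 2) ^ CARD('n))
        * (P * ((real M + 4) / (5 * (real M)\<^sup>2)) ^ CARD('m))"
  proof (intro add_mono mult_right_mono)
    have "card X1 \<le> card {x :: int^'n. \<forall>i. x $ i \<in> {-4..4}}"
      by (intro card_mono finite_vec_components) (auto simp: X1_def)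
    then have "card X1 \<le> 9 ^ CARD('n)" by (simp only: card_vec_components) simp
    then have "real (card X1) \<le> real (9 ^ CARD('n))" by (rule of_nat_mono)
    then show "real (card X1) \<le> 9 ^ CARD('n)" by simp
    have "card X2 \<le> card {x :: int^'n. norm (real_vec x) \<le> \<rho>}"
      by (intro card_mono finite_int_points_ball assms) (auto simp: X2_def)
    then show "real (card X2) \<le> unit_ball_vol (real CARD('n)) * (\<rho> + sqrt (real CARD('n)) / 2) ^ CARD('n)"
      using card_int_points_ball[OF assms(1), where 'n = 'n] by linarith
  next
    have "P \<ge> 0" by (simp add: P_def)
    then show "0 \<le> P * (1 / real M ^ CARD('m))" "0 \<le> P * ((real M + 4) / (5 * (real M)\<^sup>2)) ^ CARD('m)"
      by (auto intro!: mult_nonneg_nonneg)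
  qed
  also have "\<dots> = P * (9 ^ CARD('n) / real M ^ CARD('m) +
      unit_ball_vol (real CARD('n)) * (\<rho> + sqrt (real CARD('n)) / 2) ^ CARD('n) *
        ((real M + 4) / (5 * (real M)\<^sup>2)) ^ CARD('m))"
    unfolding distrib_left by (intro arg_cong2[where f = "(+)"]) (simp, rule mult.left_commute)
  finally show ?thesis unfolding P_def .
qed

section \<open>Reverse branch-and-bound\<close>

text \<open>Two admissible integers would differ by at least 1, although both lie between values of
  coordinate \<open>i\<close> on \<open>P\<close>.\<close>

lemma branch_subset_singleton:
  assumes "\<And>y z. y \<in> P \<Longrightarrow> z \<in> P \<Longrightarrow> y i - z i < 1"
  shows "\<exists>g :: int. branch i P \<subseteq> {P \<inter> {y. y i = real_of_int g}}"
proof (cases "branch i P = {}")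
  case False
  then obtain g y y' where g: "y \<in> P" "y i \<le> real_of_int g" "y' \<in> P" "real_of_int g \<le> y' i"
    by (auto simp: branch_def)
  have "h = g" if h: "z \<in> P" "z i \<le> real_of_int h" "z' \<in> P" "real_of_int h \<le> z' i" for h z z'
    using assms[OF g(3) h(1)] assms[OF h(3) g(1)] g h by linarith
  then have "branch i P \<subseteq> {P \<inter> {y. y i = real_of_int g}}" unfolding branch_def by blast
  then show ?thesis ..
qed simp

text \<open>In the inner product with \<open>gso B i\<close>, orthogonality removes the columns
  before \<open>i\<close> and \<open>eq\<close> those after \<open>i\<close>, leaving
  \<open>(y i - z i) * (norm (gso B i))\<^sup>2\<close>. The difference \<open>w\<close> of two
  points of a unit cube has norm at most \<open>sqrt n\<close>, so Cauchy-Schwarz concludes.\<close>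

lemma Q_N_coordinate_width:
  fixes B :: "nat \<Rightarrow> real^'n"
  assumes y: "y \<in> Q_N r B x0" and z: "z \<in> Q_N r B x0" and i: "i \<in> {1..r}"
    and eq: "\<And>j. i < j \<Longrightarrow> j \<le> r \<Longrightarrow> y j = z j" and big: "sqrt (real CARD('n)) < norm (gso B i)"
  shows "y i - z i < 1"
proof -
  define w where "w = (\<Sum>j\<in>{1..r}. (y j - z j) *\<^sub>R B j)"
  have w: "w = (\<Sum>j\<in>{1..r}. y j *\<^sub>R B j) - (\<Sum>j\<in>{1..r}. z j *\<^sub>R B j)"
    by (simp add: w_def scaleR_diff_left sum_subtractf)
  have comp: "\<bar>w $ k\<bar> \<le> 1" for k
  proof -
    have "- real_of_int (x0 $ k) \<le> (\<Sum>j\<in>{1..r}. y j *\<^sub>R B j) $ k"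
      "(\<Sum>j\<in>{1..r}. y j *\<^sub>R B j) $ k \<le> 1 - real_of_int (x0 $ k)"
      "- real_of_int (x0 $ k) \<le> (\<Sum>j\<in>{1..r}. z j *\<^sub>R B j) $ k"
      "(\<Sum>j\<in>{1..r}. z j *\<^sub>R B j) $ k \<le> 1 - real_of_int (x0 $ k)"
      using y z unfolding Q_N_def by blast+
    then show ?thesis unfolding w vector_minus_component by linarith
  qed
  have "(w $ k)\<^sup>2 \<le> 1" for k using comp[of k] by (simp add: abs_square_le_1)
  then have "(\<Sum>k\<in>UNIV. (w $ k)\<^sup>2) \<le> (\<Sum>k\<in>(UNIV :: 'n set). 1)" by (intro sum_mono)
  then have "norm w \<le> sqrt (real CARD('n))"
    unfolding norm_vec_def L2_set_def by simp
  have "w \<bullet> gso B i = (\<Sum>j\<in>{1..r}. (y j - z j) * (B j \<bullet> gso B i))"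
    by (simp add: w_def inner_sum_left)
  also have "\<dots> = (\<Sum>j\<in>{i}. (y j - z j) * (B j \<bullet> gso B i))"
  proof (rule sum.mono_neutral_right)
    show "\<forall>j\<in>{1..r} - {i}. (y j - z j) * (B j \<bullet> gso B i) = 0"
    proof
      fix j assume "j \<in> {1..r} - {i}"
      then show "(y j - z j) * (B j \<bullet> gso B i) = 0"
        using eq[of j] inner_gso_lower[of j i B] by (cases "j < i") auto
    qed
  qed (use i in auto)
  also have "\<dots> = (y i - z i) * (norm (gso B i) * norm (gso B i))"
    by (simp add: inner_gso_self dot_square_norm power2_eq_square)
  finally have "(y i - z i) * norm (gso B i) * norm (gso B i) = w \<bullet> gso B i" by simp
  also have "\<dots> \<le> norm w * norm (gso B i)" by (rule norm_cauchy_schwarz)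
  also have "\<dots> < norm (gso B i) * norm (gso B i)"
    using \<open>norm w \<le> _\<close> big by (intro mult_strict_right_mono) (auto intro: order.strict_trans1[of 0 "sqrt (real CARD('n))"])
  finally have "(y i - z i) * norm (gso B i) < 1 * norm (gso B i)"
    by (simp add: mult_less_cancel_right)
  moreover have "0 < norm (gso B i)"
    using big real_sqrt_ge_zero[of "real CARD('n)"] by linarith
  ultimately show ?thesis by (simp only: mult_less_cancel_right_pos)
qed

lemma solves_at_rootnode_Q_N:
  fixes B :: "nat \<Rightarrow> real^'n"
  assumes big: "\<And>i. i \<in> {1..r} \<Longrightarrow> sqrt (real CARD('n)) < norm (gso B i)"
  shows "solves_at_rootnode r (Q_N r B x0)"
proof -
  let ?Q = "Q_N r B x0"
  \<comment> \<open>After \<open>k\<close> branchings the coordinates above \<open>r - k\<close> are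
    constant on the only possible node, and \<open>r - k\<close> is the next one to be branched on.
    This constancy is what the width estimate requires.\<close>
  have nodes: "\<exists>P\<subseteq>?Q. bb_nodes r ?Q k \<subseteq> {P} \<and> (\<forall>y\<in>P. \<forall>z\<in>P. \<forall>j. r - k < j \<and> j \<le> r \<longrightarrow> y j = z j)"
    if "k \<le> r" for k
    using that
  proof (induction k)
    case 0
    then show ?case by auto
  next
    case (Suc k)
    then obtain P where P: "P \<subseteq> ?Q" "bb_nodes r ?Q k \<subseteq> {P}"
      "\<And>y z j. y \<in> P \<Longrightarrow> z \<in> P \<Longrightarrow> r - k < j \<Longrightarrow> j \<le> r \<Longrightarrow> y j = z j"
      by (metis Suc_leD)
    define i where "i = r - k"
    have i: "i \<in> {1..r}" using Suc.prems by (auto simp: i_def)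
    have "y i - z i < 1" if "y \<in> P" "z \<in> P" for y z
      by (rule Q_N_coordinate_width[OF _ _ i _ big[OF i]]) (use that P in \<open>auto simp: i_def\<close>)
    then obtain g :: int where g: "branch i P \<subseteq> {P \<inter> {y. y i = real_of_int g}}"
      using branch_subset_singleton by blast
    let ?P = "P \<inter> {y. y i = real_of_int g}"
    have "bb_nodes r ?Q (Suc k) \<subseteq> {?P}" using P(2) g by (auto simp: i_def)
    moreover have "y j = z j" if "y \<in> ?P" "z \<in> ?P" "r - Suc k < j" "j \<le> r" for y z j
    proof (cases "j = i")
      case False
      with that(3) have "r - k < j" by (simp add: i_def)
      with that P(3) show ?thesis by blast
    qed (use that in simp)
    ultimately show ?case using P(1) by (intro exI[of _ ?P]) blast
  qed
  show ?thesis
    unfolding solves_at_rootnode_def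
  proof
    fix k assume "k \<in> {1..r}"
    then obtain P where "bb_nodes r ?Q k \<subseteq> {P}" using nodes[of k] by auto
    then show "finite (bb_nodes r ?Q k) \<and> card (bb_nodes r ?Q k) \<le> 1"
      using finite_subset card_mono[of "{P}"] by fastforce
  qed
qed

section \<open>From short kernel vectors to percentages\<close>

lemma always_solved_at_rootnode_if_no_short_kernel_vector:
  fixes A :: "int^'n^'m"
  defines "\<rho> \<equiv> sqrt (real CARD('n)) * (1 + real (CARD('n) - CARD('m)) / 4)"
  assumes r: "CARD('n) - CARD('m) \<le> 30" and no: "\<nexists>x. x \<noteq> 0 \<and> A *v x = 0 \<and> norm (real_vec x) \<le> \<rho>"
  shows "always_solved_at_rootnode A"
  unfolding always_solved_at_rootnode_def
proof (intro allI impI)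
  fix b Q assume "RKZ_nullspace_reformulation A b Q"
  then obtain B x0 where B: "RKZ_reduced_basis (CARD('n) - CARD('m)) B (null_lattice A)"
    and Q: "Q = Q_N (CARD('n) - CARD('m)) B x0" unfolding RKZ_nullspace_reformulation_def by blast
  have "sqrt (real CARD('n)) < norm (gso B i)" if i: "i \<in> {1..CARD('n) - CARD('m)}" for i
    using B i r
  proof (rule RKZ_gso_norm_greater)
    fix w assume "w \<in> null_lattice A" "w \<noteq> 0"
    then obtain x where x: "w = real_vec x" "A *v x = 0" by (auto simp: null_lattice_def)
    moreover have "x \<noteq> 0" using x(1) \<open>w \<noteq> 0\<close> by (auto simp: real_vec_def vec_eq_iff)
    ultimately have "\<not> norm w \<le> \<rho>" using no by blast
    then show "sqrt (real CARD('n)) * (1 + real (CARD('n) - CARD('m)) / 4) \<le> norm w" by (simp add: \<rho>_def)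
  qed simp
  then show "solves_at_rootnode (CARD('n) - CARD('m)) Q" unfolding Q by (rule solves_at_rootnode_Q_N)
qed

text \<open>The auxiliary naturals keep the final numerical checks small: \<open>\<alpha>\<close> bounds
  \<open>3.15 * n * (3 / 2 + r / 4)\<^sup>2\<close>, where \<open>pi < 3.15\<close>, and \<open>1 / q\<close> bounds the probability
  \<open>(M + 4) / (5 * M\<^sup>2)\<close>.\<close>

lemma fraction_always_solved_at_rootnode:
  fixes M k m r \<alpha> q d :: nat
  assumes n: "CARD('n::finite) = 2 * k" and m: "CARD('m::finite) = m" and r: "r = 2 * k - m" "r \<le> 30"
    and chi: "mat_chi TYPE('m) TYPE('n) M \<ge> 1 / 2" and pos: "M > 0" "q > 0" "d > 0"
    and \<alpha>: "63 * (2 * k) * (6 + r)\<^sup>2 \<le> 320 * \<alpha>" and q: "q * (M + 4) \<le> 5 * M\<^sup>2"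
    and small: "d * 81 ^ k \<le> M ^ m" and large: "d * \<alpha> ^ k \<le> fact k * q ^ m"
  shows "real (card {A \<in> mat_G' M :: (int^'n^'m) set. always_solved_at_rootnode A})
    \<ge> (1 - 4 / real d) * real (card (mat_G' M :: (int^'n^'m) set))"
proof -
  let ?G = "mat_G M :: (int^'n^'m) set" and ?G' = "mat_G' M :: (int^'n^'m) set"
  define \<rho> where "\<rho> = sqrt (real CARD('n)) * (1 + real (CARD('n) - CARD('m)) / 4)"
  define S where "S = {A \<in> ?G'. always_solved_at_rootnode A}"
  define Bad where "Bad = {A \<in> ?G. \<exists>x. x \<noteq> 0 \<and> A *v x = 0 \<and> norm (real_vec x) \<le> \<rho>}"
  have "\<rho> \<ge> 0" by (simp add: \<rho>_def)
  have G': "?G' \<subseteq> ?G" by (auto simp: mat_G'_def)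
  have finBad: "finite Bad" unfolding Bad_def by (rule finite_subset[OF _ finite_mat_G[of M]]) auto
  have finS: "finite S" by (rule finite_subset[OF _ finite_mat_G[of M]]) (use G' in \<open>auto simp: S_def\<close>)
  have "A \<in> S \<union> Bad" if A: "A \<in> ?G'" for A
  proof (cases "\<exists>x. x \<noteq> 0 \<and> A *v x = 0 \<and> norm (real_vec x) \<le> \<rho>")
    case True
    then show ?thesis using A G' by (auto simp: Bad_def)
  next
    case False
    then have "always_solved_at_rootnode A"
      unfolding \<rho>_def using r n m by (intro always_solved_at_rootnode_if_no_short_kernel_vector) auto
    then show ?thesis using A by (simp add: S_def)
  qed
  then have "card ?G' \<le> card (S \<union> Bad)" using finS finBad by (intro card_mono) auto
  also have "\<dots> \<le> card S + card Bad" by (rule card_Un_le)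
  finally have le: "real (card ?G') \<le> real (card S) + real (card Bad)" by linarith
  \<comment> \<open>Adding half the cube diagonal turns \<open>\<rho>\<close> into
    \<open>sqrt n * (3 / 2 + r / 4)\<close>. As \<open>n = 2 * k\<close>, the power is a
    \<open>k\<close>-th power of a rational; the even dimension also gives the ball volume
    \<open>pi ^ k / fact k\<close>.\<close>
  have ball: "(\<rho> + sqrt (real CARD('n)) / 2) ^ CARD('n) = (real (2 * k) * (3 / 2 + real r / 4)\<^sup>2) ^ k"
  proof -
    have "\<rho> + sqrt (real CARD('n)) / 2 = sqrt (real (2 * k)) * (3 / 2 + real r / 4)"
      unfolding \<rho>_def n m r(1) by (simp add: algebra_simps)
    then have "(\<rho> + sqrt (real CARD('n)) / 2)\<^sup>2 = real (2 * k) * (3 / 2 + real r / 4)\<^sup>2"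
      by (simp only: power_mult_distrib real_sqrt_pow2 of_nat_0_le_iff)
    then show ?thesis unfolding n power_mult by simp
  qed
  have vol: "unit_ball_vol (real CARD('n)) \<le> 3.15 ^ k / fact k"
    unfolding n unit_ball_vol_even using pi_bounds pi_ge_zero
    by (intro divide_right_mono power_mono) auto
  have "9 ^ CARD('n) / real M ^ CARD('m) = real (81 ^ k) / real (M ^ m)"
    by (simp add: n m power_mult)
  also have "\<dots> \<le> 1 / real d"
  proof -
    have "real (d * 81 ^ k) \<le> real (M ^ m)" using small by (rule of_nat_mono)
    then show ?thesis using pos by (simp add: field_simps)
  qed
  finally have first: "9 ^ CARD('n) / real M ^ CARD('m) \<le> 1 / real d" .
  have "3.15 * (real (2 * k) * (3 / 2 + real r / 4)\<^sup>2) \<le> real \<alpha>"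
  proof -
    have "real (63 * (2 * k) * (6 + r)\<^sup>2) \<le> real (320 * \<alpha>)" using \<alpha> by (rule of_nat_mono)
    then have "63 * (2 * real k) * (6 + real r)\<^sup>2 \<le> 320 * real \<alpha>" by simp
    moreover have "(6 + real r)\<^sup>2 = 16 * (3 / 2 + real r / 4)\<^sup>2" by (simp add: power2_eq_square field_simps)
    ultimately show ?thesis by simp
  qed
  then have "(3.15 * (real (2 * k) * (3 / 2 + real r / 4)\<^sup>2)) ^ k \<le> real \<alpha> ^ k"
    by (rule power_mono) simp
  then have "3.15 ^ k / fact k * (\<rho> + sqrt (real CARD('n)) / 2) ^ CARD('n) \<le> real \<alpha> ^ k / fact k"
    unfolding ball power_mult_distrib[of "3.15"] by (simp add: divide_right_mono)
  moreover have "unit_ball_vol (real CARD('n)) * (\<rho> + sqrt (real CARD('n)) / 2) ^ CARD('n)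
      \<le> 3.15 ^ k / fact k * (\<rho> + sqrt (real CARD('n)) / 2) ^ CARD('n)"
    using vol \<open>\<rho> \<ge> 0\<close> by (intro mult_right_mono) auto
  ultimately have count: "unit_ball_vol (real CARD('n)) * (\<rho> + sqrt (real CARD('n)) / 2) ^ CARD('n)
      \<le> real \<alpha> ^ k / fact k" by (rule order.trans[rotated])
  have "(real M + 4) / (5 * (real M)\<^sup>2) \<le> 1 / real q"
  proof -
    have "real (q * (M + 4)) \<le> real (5 * M\<^sup>2)" using q by (rule of_nat_mono)
    then show ?thesis using pos by (simp add: field_simps)
  qed
  then have "((real M + 4) / (5 * (real M)\<^sup>2)) ^ CARD('m) \<le> (1 / real q) ^ m"
    unfolding m by (rule power_mono) simp
  with count have "unit_ball_vol (real CARD('n)) * (\<rho> + sqrt (real CARD('n)) / 2) ^ CARD('n)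
      * ((real M + 4) / (5 * (real M)\<^sup>2)) ^ CARD('m) \<le> real \<alpha> ^ k / fact k * (1 / real q) ^ m"
    by (rule mult_mono) auto
  also have "\<dots> \<le> 1 / real d"
  proof -
    have "real (d * \<alpha> ^ k) \<le> real (fact k * q ^ m)" using large by (rule of_nat_mono)
    then show ?thesis using pos by (simp add: field_simps)
  qed
  finally have second: "unit_ball_vol (real CARD('n)) * (\<rho> + sqrt (real CARD('n)) / 2) ^ CARD('n)
      * ((real M + 4) / (5 * (real M)\<^sup>2)) ^ CARD('m) \<le> 1 / real d" .
  have "real (card Bad) \<le> real (card ?G) *
      (9 ^ CARD('n) / real M ^ CARD('m) +
       unit_ball_vol (real CARD('n)) * (\<rho> + sqrt (real CARD('n)) / 2) ^ CARD('n) *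
         ((real M + 4) / (5 * (real M)\<^sup>2)) ^ CARD('m))"
    unfolding Bad_def using \<open>\<rho> \<ge> 0\<close> pos(1) by (rule card_matrices_short_kernel_vector)
  also have "\<dots> \<le> real (card ?G) * (1 / real d + 1 / real d)"
    by (intro mult_left_mono add_mono first second of_nat_0_le_iff)
  \<comment> \<open>Passage from all matrices to those with independent rows, by the hypothesis on
    \<open>mat_chi\<close>.\<close>
  also have "\<dots> \<le> (2 * real (card ?G')) * (1 / real d + 1 / real d)"
  proof (rule mult_right_mono)
    have "real (card ?G) > 0" using pos by (simp add: card_mat_G)
    then show "real (card ?G) \<le> 2 * real (card ?G')"
      using chi by (simp add: mat_chi_def field_simps)
  qed simp
  also have "\<dots> = 4 / real d * real (card ?G')" by simp
  finally show ?thesis using le unfolding S_def[symmetric] by (simp only: left_diff_distrib mult_1)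
qed

theorem proposition2:
  fixes M90 M99 :: nat
  assumes "(CARD('n::finite), CARD('m::finite), M90, M99) \<in>
    {(30, 20, 33, 37), (50, 20, 1912, 2145), (50, 30, 96, 103), (60, 30, 420, 454), (70, 40, 197, 209)}"
  shows "(mat_chi TYPE('m) TYPE('n) M90 \<ge> 1 / 2 \<longrightarrow>
      real (card {A \<in> mat_G' M90 :: (int^'n^'m) set. always_solved_at_rootnode A})
        \<ge> 90 / 100 * real (card (mat_G' M90 :: (int^'n^'m) set)))
    \<and> (mat_chi TYPE('m) TYPE('n) M99 \<ge> 1 / 2 \<longrightarrow>
      real (card {A \<in> mat_G' M99 :: (int^'n^'m) set. always_solved_at_rootnode A})
        \<ge> 99 / 100 * real (card (mat_G' M99 :: (int^'n^'m) set)))"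
proof -
  consider (a) "CARD('n) = 2 * 15" "CARD('m) = 20" "M90 = 33" "M99 = 37"
    | (b) "CARD('n) = 2 * 25" "CARD('m) = 20" "M90 = 1912" "M99 = 2145"
    | (c) "CARD('n) = 2 * 25" "CARD('m) = 30" "M90 = 96" "M99 = 103"
    | (d) "CARD('n) = 2 * 30" "CARD('m) = 30" "M90 = 420" "M99 = 454"
    | (e) "CARD('n) = 2 * 35" "CARD('m) = 40" "M90 = 197" "M99 = 209"
    using assms by auto
  then show ?thesis
  proof cases
    case a
    \<comment> \<open>The values 40 and 400 of \<open>d\<close> solve
      \<open>1 - 4 / d = 90 / 100\<close> and \<open>1 - 4 / d = 99 / 100\<close>. In all five cases
      \<open>\<alpha>\<close> is the least and \<open>q\<close> the greatest natural number allowed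
      by its defining inequality.\<close>
    have "90 / 100 * real (card (mat_G' M90 :: (int^'n^'m) set))
        \<le> real (card {A \<in> mat_G' M90 :: (int^'n^'m) set. always_solved_at_rootnode A})"
      if "mat_chi TYPE('m) TYPE('n) M90 \<ge> 1 / 2"
      using fraction_always_solved_at_rootnode[OF a(1,2) refl _ that, where d = 40 and \<alpha> = 1512 and q = 147]
      by (simp add: a(3) fact_numeral)
    moreover have "99 / 100 * real (card (mat_G' M99 :: (int^'n^'m) set))
        \<le> real (card {A \<in> mat_G' M99 :: (int^'n^'m) set. always_solved_at_rootnode A})"
      if "mat_chi TYPE('m) TYPE('n) M99 \<ge> 1 / 2"
      using fraction_always_solved_at_rootnode[OF a(1,2) refl _ that, where d = 400 and \<alpha> = 1512 and q = 166]
      by (simp add: a(4) fact_numeral)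
    ultimately show ?thesis by blast
  next
    case b
    have "90 / 100 * real (card (mat_G' M90 :: (int^'n^'m) set))
        \<le> real (card {A \<in> mat_G' M90 :: (int^'n^'m) set. always_solved_at_rootnode A})"
      if "mat_chi TYPE('m) TYPE('n) M90 \<ge> 1 / 2"
      using fraction_always_solved_at_rootnode[OF b(1,2) refl _ that, where d = 40 and \<alpha> = 12758 and q = 9540]
      by (simp add: b(3) fact_numeral)
    moreover have "99 / 100 * real (card (mat_G' M99 :: (int^'n^'m) set))
        \<le> real (card {A \<in> mat_G' M99 :: (int^'n^'m) set. always_solved_at_rootnode A})"
      if "mat_chi TYPE('m) TYPE('n) M99 \<ge> 1 / 2"
      using fraction_always_solved_at_rootnode[OF b(1,2) refl _ that, where d = 400 and \<alpha> = 12758 and q = 10705]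
      by (simp add: b(4) fact_numeral)
    ultimately show ?thesis by blast
  next
    case c
    have "90 / 100 * real (card (mat_G' M90 :: (int^'n^'m) set))
        \<le> real (card {A \<in> mat_G' M90 :: (int^'n^'m) set. always_solved_at_rootnode A})"
      if "mat_chi TYPE('m) TYPE('n) M90 \<ge> 1 / 2"
      using fraction_always_solved_at_rootnode[OF c(1,2) refl _ that, where d = 40 and \<alpha> = 6655 and q = 460]
      by (simp add: c(3) fact_numeral)
    moreover have "99 / 100 * real (card (mat_G' M99 :: (int^'n^'m) set))
        \<le> real (card {A \<in> mat_G' M99 :: (int^'n^'m) set. always_solved_at_rootnode A})"
      if "mat_chi TYPE('m) TYPE('n) M99 \<ge> 1 / 2"
      using fraction_always_solved_at_rootnode[OF c(1,2) refl _ that, where d = 400 and \<alpha> = 6655 and q = 495]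
      by (simp add: c(4) fact_numeral)
    ultimately show ?thesis by blast
  next
    case d
    have "90 / 100 * real (card (mat_G' M90 :: (int^'n^'m) set))
        \<le> real (card {A \<in> mat_G' M90 :: (int^'n^'m) set. always_solved_at_rootnode A})"
      if "mat_chi TYPE('m) TYPE('n) M90 \<ge> 1 / 2"
      using fraction_always_solved_at_rootnode[OF d(1,2) refl _ that, where d = 40 and \<alpha> = 15309 and q = 2080]
      by (simp add: d(3) fact_numeral)
    moreover have "99 / 100 * real (card (mat_G' M99 :: (int^'n^'m) set))
        \<le> real (card {A \<in> mat_G' M99 :: (int^'n^'m) set. always_solved_at_rootnode A})"
      if "mat_chi TYPE('m) TYPE('n) M99 \<ge> 1 / 2"
      using fraction_always_solved_at_rootnode[OF d(1,2) refl _ that, where d = 400 and \<alpha> = 15309 and q = 2250]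
      by (simp add: d(4) fact_numeral)
    ultimately show ?thesis by blast
  next
    case e
    have "90 / 100 * real (card (mat_G' M90 :: (int^'n^'m) set))
        \<le> real (card {A \<in> mat_G' M90 :: (int^'n^'m) set. always_solved_at_rootnode A})"
      if "mat_chi TYPE('m) TYPE('n) M90 \<ge> 1 / 2"
      using fraction_always_solved_at_rootnode[OF e(1,2) refl _ that, where d = 40 and \<alpha> = 17861 and q = 965]
      by (simp add: e(3) fact_numeral)
    moreover have "99 / 100 * real (card (mat_G' M99 :: (int^'n^'m) set))
        \<le> real (card {A \<in> mat_G' M99 :: (int^'n^'m) set. always_solved_at_rootnode A})"
      if "mat_chi TYPE('m) TYPE('n) M99 \<ge> 1 / 2"
      using fraction_always_solved_at_rootnode[OF e(1,2) refl _ that, where d = 400 and \<alpha> = 17861 and q = 1025]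
      by (simp add: e(4) fact_numeral)
    ultimately show ?thesis by blast
  qed
qed

end
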